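(* Let $\widehat B_n(x)=\sum_{\pi\in B_n}x^{altdes_B(\pi)}$ be the alternating Eulerian polynomial of type $B$ (with $\widehat B_0(x)=1$). Then: (i) $\widehat B_n(x)=(1-x)^n\,Q^{(1)}_n\!\left(\frac{1+x}{1-x}\right)$, where $Q^{(1)}_0(x)=1$ and $Q^{(1)}_{n+1}(x)=xQ^{(1)}_n(x)+(1+x^2)\frac{d}{dx}Q^{(1)}_n(x)$; (ii) $\widehat B_n(x)$ is symmetric and unimodal for any $n\ge3$; (iii) $$\sum_{n\ge0}\widehat B_n(x)\frac{t^n}{n!}=\frac{1-x}{(1-x)\cos((1-x)t)-(1+x)\sin((1-x)t)};$$ (iv) $$\sum_{n=0}^\infty\widehat B_n(x)t^n=\cfrac{1}{1-r_0t-\cfrac{s_1t^2}{1-r_1t-\cfrac{s_2t^2}{1-r_2t-\cdots}}},$$ where $r_i=(2i+1)(1+x)$ and $s_i=2i^2(1+x^2)$ for $i\ge0$; (v) the polynomial sequence $(\widehat B_n(q))_{n\ge0}$ is strongly $q$-log-convex; (vi) $\widehat B_n(x)$ is Hurwitz stable and semi-$\gamma$-positive for $n\ge1$; (vii) $$\widehat B_n(x)=\sum_{k\ge0}(-4)^k\Bigl[\sum_{i\ge0}\widetilde W_{n,i}\binom ik\Bigr]x^k(1+x)^{n-2k},$$ where $\widetilde W_{n,i}$ is the number of permutations of $\{1,\dots,n\}$ with $i$ left peaks; moreover $\widehat B_n(x)$ is not $\gamma$-positive for $n\ge2$.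
   Context: $B_n$ is the set of signed permutations of $\{\pm1,\dots,\pm n\}$ (bijections $\pi$ with $\pi(-i)=-\pi(i)$). With $\pi(0)=0$, $altdes_B(\pi)=|\{2i:\pi(2i)<\pi(2i+1)\}\cup\{2i+1:\pi(2i+1)>\pi(2i+2)\}|$, where $i\ge0$ and all arguments of $\pi$ lie in $\{0,1,\dots,n\}$. For $\pi\in S_n$ with $\pi_0=0$, a left peak is an index $i\in\{1,\dots,n-1\}$ with $\pi_{i-1}<\pi_i>\pi_{i+1}$ (and $\widetilde W_{0,0}=1$). A polynomial of degree $d$ is symmetric if $f(x)=x^df(1/x)$; $f=\sum f_kx^k$ is unimodal if $f_0\le\cdots\le f_m\ge\cdots\ge f_d$ for some $m$. A sequence $(f_n(q))_{n\ge0}$ is strongly $q$-log-convex if $f_{n+1}(q)f_{m-1}(q)-f_n(q)f_m(q)$ has only nonnegative coefficients for all $n\ge m\ge1$. A polynomial is Hurwitz stable if it is identically zero or has no zeros in $\Re(x)>0$. A symmetric polynomial of degree $d=2N+\nu$, $\nu\in\{0,1\}$, is semi-$\gamma$-positive if $f(x)=(1+x)^\nu\sum_{k=0}^Ng_kx^k(1+x^2)^{N-k}$ with all $g_k\ge0$, and $\gamma$-positive if $f(x)=\sum_{k=0}^{\lfloor d/2\rfloor}g_kx^k(1+x)^{d-2k}$ with all $g_k\ge0$.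
   Formalization: In (vii) the inner sum is corrected to Σ_i 2^(i-k) W̃_{n,i} C(i,k); as printed, without 2^(i-k), the formula fails already for n=2, giving 2+2x² instead of 3+2x+3x². *)

theory Defs
  imports
    Complex_Main
    "HOL-Computational_Algebra.Computational_Algebra"
    "HOL-Combinatorics.Permutations"
begin

(* The clause "permutes" makes an element the identity outside {-n..n} - {0}, so that the set is
   finite, pi 0 = 0 holds, and oddness at all integers is the same as oddness on {-n..n} - {0}. *)
definition signed_perms :: "nat \<Rightarrow> (int \<Rightarrow> int) set" where
  "signed_perms n =
     {\<pi>. \<pi> permutes ({- int n..int n} - {0}) \<and> (\<forall>i. \<pi> (- i) = - \<pi> i)}"

definition altdes_B :: "nat \<Rightarrow> (int \<Rightarrow> int) \<Rightarrow> nat" where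
  "altdes_B n \<pi> = card
     ({2 * i | i :: nat. 2 * i + 1 \<le> n \<and> \<pi> (int (2 * i)) < \<pi> (int (2 * i + 1))} \<union>
      {2 * i + 1 | i :: nat. 2 * i + 2 \<le> n \<and> \<pi> (int (2 * i + 1)) > \<pi> (int (2 * i + 2))})"

definition alt_eulerian_B :: "nat \<Rightarrow> real poly" where
  "alt_eulerian_B n = (\<Sum>\<pi>\<in>signed_perms n. monom 1 (altdes_B n \<pi>))"

primrec Q1 :: "nat \<Rightarrow> real poly" where
  "Q1 0 = 1"
| "Q1 (Suc n) = [:0, 1:] * Q1 n + [:1, 0, 1:] * pderiv (Q1 n)"

(* A permutation of {1..n} in the sense of "permutes" fixes 0, which is the convention pi_0 = 0. *)
definition left_peaks :: "nat \<Rightarrow> (nat \<Rightarrow> nat) \<Rightarrow> nat set" where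
  "left_peaks n \<pi> = {i \<in> {1..n - 1}. \<pi> (i - 1) < \<pi> i \<and> \<pi> i > \<pi> (i + 1)}"

(* Left peaks are never adjacent, so left_peak_count n i = 0 for 2 * i > n.  Expanding
   (2 * (1 + x^2))^i = (2 * (1 + x)^2 - 4 * x)^i binomially produces the weights 2^(i - k) * (i choose k)
   in the expansion of alt_eulerian_B; without the factor 2^(i - k) that expansion would have
   constant term n!, whereas alt_eulerian_B 2 has constant term 3. *)
definition left_peak_count :: "nat \<Rightarrow> nat \<Rightarrow> nat" where
  "left_peak_count n i = card {\<pi>. \<pi> permutes {1..n} \<and> card (left_peaks n \<pi>) = i}"

(* reflect_poly f is x^d f(1/x) for d = degree f. *)
definition symmetric_poly :: "real poly \<Rightarrow> bool" where
  "symmetric_poly f \<longleftrightarrow> reflect_poly f = f"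

definition unimodal_poly :: "real poly \<Rightarrow> bool" where
  "unimodal_poly f \<longleftrightarrow> (\<exists>m \<le> degree f.
     (\<forall>k<m. coeff f k \<le> coeff f (k + 1)) \<and>
     (\<forall>k. m \<le> k \<and> k < degree f \<longrightarrow> coeff f k \<ge> coeff f (k + 1)))"

definition semi_gamma_positive :: "real poly \<Rightarrow> bool" where
  "semi_gamma_positive f \<longleftrightarrow> symmetric_poly f \<and>
     (let N = degree f div 2; \<nu> = degree f mod 2 in
        \<exists>g :: nat \<Rightarrow> real. (\<forall>k\<le>N. g k \<ge> 0) \<and>
          f = [:1, 1:] ^ \<nu> * (\<Sum>k\<le>N. smult (g k) ([:0, 1:] ^ k * [:1, 0, 1:] ^ (N - k))))"

definition gamma_positive :: "real poly \<Rightarrow> bool" where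
  "gamma_positive f \<longleftrightarrow> symmetric_poly f \<and>
     (let d = degree f in
        \<exists>g :: nat \<Rightarrow> real. (\<forall>k\<le>d div 2. g k \<ge> 0) \<and>
          f = (\<Sum>k\<le>d div 2. smult (g k) ([:0, 1:] ^ k * [:1, 1:] ^ (d - 2 * k))))"

definition hurwitz_stable :: "real poly \<Rightarrow> bool" where
  "hurwitz_stable f \<longleftrightarrow>
     f = 0 \<or> (\<forall>z :: complex. Re z > 0 \<longrightarrow> poly (map_poly complex_of_real f) z \<noteq> 0)"

definition strongly_q_log_convex :: "(nat \<Rightarrow> real poly) \<Rightarrow> bool" where
  "strongly_q_log_convex f \<longleftrightarrow> (\<forall>n m. n \<ge> m \<and> m \<ge> 1 \<longrightarrow>
     (\<forall>k. coeff (f (n + 1) * f (m - 1) - f n * f m) k \<ge> 0))"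

(* jfrac r s m i is the fraction starting at level i, with everything below its first m levels
   replaced by 0.  The denominators have constant term 1, so the division is exact.  The value of
   the infinite fraction is the limit over m of jfrac r s m 0 in the t-adic topology, which is the
   metric topology on fps. *)
primrec jfrac :: "(nat \<Rightarrow> 'a :: field) \<Rightarrow> (nat \<Rightarrow> 'a) \<Rightarrow> nat \<Rightarrow> nat \<Rightarrow> 'a fps" where
  "jfrac r s 0 i = 0"
| "jfrac r s (Suc m) i =
     1 / (1 - fps_const (r i) * fps_X - fps_const (s (i + 1)) * fps_X ^ 2 * jfrac r s m (i + 1))"

(* Identities involving 1/(1 - x) are stated in the field of rational functions in x,
   or in the power series ring in t over that field. *)
abbreviation ratX :: "real poly fract" where
  "ratX \<equiv> to_fract [:0, 1:]"

end

theory Submission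
  imports Defs
begin

text \<open>
  Multiplying the entries of a signed permutation by alternating signs turns alternating descents into pairs of
  neighbours whose entry of larger absolute value is negative.  Summing over all signs first gives
  \<open>B_n(x) = \<Sum>\<tau>. (2 (1 + x\<^sup>2)) ^ p (1 + x) ^ (n - 2 p)\<close> over the permutations \<open>\<tau>\<close> of \<open>{1..n}\<close>, where \<open>p\<close> is the
  number of left peaks of \<open>\<tau>\<close>; this yields the (semi-)\<open>\<gamma>\<close>-expansions.  Inserting the maximum \<open>n + 1\<close> keeps the
  number of left peaks in \<open>2 p + 1\<close> positions and increases it in the other \<open>n - 2 p\<close>, which is the recurrence for
  \<open>Q_n(y) = \<Sum>\<tau>. (1 + y\<^sup>2) ^ p y ^ (n - 2 p)\<close>.  The generating function, the continued fraction and the location of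
  the zeros are read off from \<open>Q_n\<close>, unimodality from the recurrence for the coefficients of \<open>B_n\<close>, and
  \<open>q\<close>-log-convexity from the total positivity of the Stieltjes matrix of the continued fraction.
\<close>

section \<open>Alternating descents and left peaks\<close>

text \<open>The sum over left peaks is the hub because \<open>Q1\<close> and
  \<open>alt_eulerian_B\<close> differ only in the weights of its factors, and
  \<open>y = (1 + x) / (1 - x)\<close> exchanges these weights up to powers of \<open>1 - x\<close>.
  The two gamma-type expansions come from the single relation
  \<open>(1 + x)^2 = 2 x + (1 + x^2)\<close>: eliminating \<open>(1 + x)^2\<close> produces only
  nonnegative coefficients, while eliminating \<open>1 + x^2\<close> produces the alternating powers
  of \<open>-4\<close>. Unimodality is the part without a structural reason. Gamma-positivity, from
  which it would follow, fails, and semi-gamma-positivity does not imply it: for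
  \<open>n = 2\<close> the polynomial is \<open>3 + 2 x + 3 x^2\<close>. The argument therefore has
  to start at \<open>n = 3\<close> and works with the coefficients themselves; next to the middle,
  one step of the recurrence leaves a negative term, so two steps are combined there.\<close>

text \<open>
  With \<open>\<sigma> i = (-1) ^ i * \<pi> i\<close>, both kinds of alternating descents of \<open>\<pi>\<close> become the condition
  \<open>\<sigma> i + \<sigma> (i + 1) < 0\<close>, that is, the entry of larger absolute value is negative.  Below, \<open>\<pi>\<close> is
  encoded by \<open>\<tau> = \<bar>\<sigma>\<bar>\<close> and the set \<open>N\<close> of positions where \<open>\<sigma>\<close> is negative; \<open>up_count n \<tau> j\<close> is the number
  of neighbours of \<open>\<tau> j\<close> (including \<open>\<tau> 0 = 0\<close>) that are smaller than \<open>\<tau> j\<close>.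
\<close>

definition up_count :: "nat \<Rightarrow> (nat \<Rightarrow> nat) \<Rightarrow> nat \<Rightarrow> nat" where
  "up_count n \<tau> j = of_bool (\<tau> (j - 1) < \<tau> j) + of_bool (j < n \<and> \<tau> (j + 1) < \<tau> j)"

text \<open>The way back from the pair \<open>\<tau>\<close>, \<open>N\<close>: the power of
  \<open>- 1\<close> undoes the alternation, \<open>sgn i\<close> extends the values oddly to
  negative arguments, and the identity outside the range is what \<open>permutes\<close>
  demands.\<close>

definition signed :: "nat \<Rightarrow> (nat \<Rightarrow> nat) \<Rightarrow> nat set \<Rightarrow> int \<Rightarrow> int" where
  "signed n \<tau> N i = (if nat \<bar>i\<bar> \<in> {1..n}
     then sgn i * (- 1) ^ nat \<bar>i\<bar> * (if nat \<bar>i\<bar> \<in> N then - 1 else 1) * int (\<tau> (nat \<bar>i\<bar>))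
     else i)"

lemma abs_signed: "\<tau> permutes {1..n} \<Longrightarrow> \<bar>signed n \<tau> N i\<bar> = int (\<tau> (nat \<bar>i\<bar>))"
  using permutes_not_in[of \<tau> "{1..n}" "nat \<bar>i\<bar>"]
  by (auto simp: signed_def abs_mult power_abs abs_sgn_eq)

lemma permutes_pos: "\<tau> permutes {1..n} \<Longrightarrow> j \<ge> 1 \<Longrightarrow> \<tau> j \<ge> (1::nat)"
  using permutes_in_image[of \<tau> "{1..n}" j] permutes_not_in[of \<tau> "{1..n}" j]
  by (cases "j \<in> {1..n}") auto

lemma permutes_zero: "\<tau> permutes {1..n} \<Longrightarrow> \<tau> 0 = (0::nat)"
  by (auto simp: permutes_def)

lemma signed_uminus: "signed n \<tau> N (- i) = - signed n \<tau> N i"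
  by (simp add: signed_def)

lemma signed_inj:
  assumes \<tau>: "\<tau> permutes {1..n}" shows "inj (signed n \<tau> N)"
proof (rule injI)
  fix i j assume eq: "signed n \<tau> N i = signed n \<tau> N j"
  have "\<tau> (nat \<bar>i\<bar>) = \<tau> (nat \<bar>j\<bar>)"
    using abs_signed[OF \<tau>, of N i] abs_signed[OF \<tau>, of N j] eq by simp
  hence ij: "\<bar>i\<bar> = \<bar>j\<bar>"
    using permutes_inj[OF \<tau>] by (metis abs_ge_zero inj_def int_nat_eq)
  show "i = j"
  proof (rule ccontr)
    assume "i \<noteq> j"
    with ij have "j = - i" and "i \<noteq> 0" by auto
    hence "signed n \<tau> N i = 0" using eq signed_uminus[of n \<tau> N i] by simp
    with abs_signed[OF \<tau>, of N i] permutes_pos[OF \<tau>, of "nat \<bar>i\<bar>"] \<open>i \<noteq> 0\<close>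
    show False by (simp add: Suc_le_eq)
  qed
qed

lemma signed_in_signed_perms:
  assumes \<tau>: "\<tau> permutes {1..n}" shows "signed n \<tau> N \<in> signed_perms n"
proof -
  let ?S = "{- int n..int n} - {0}"
  have "signed n \<tau> N i \<in> ?S" if "i \<in> ?S" for i
  proof -
    have "nat \<bar>i\<bar> \<in> {1..n}" using that by auto
    hence "\<tau> (nat \<bar>i\<bar>) \<in> {1..n}" using permutes_in_image[OF \<tau>] by blast
    thus ?thesis using abs_signed[OF \<tau>, of N i] by auto
  qed
  hence "signed n \<tau> N ` ?S \<subseteq> ?S" by (rule image_subsetI)
  hence "bij_betw (signed n \<tau> N) ?S ?S"
    using inj_on_subset[OF signed_inj[OF \<tau>, of N] subset_UNIV]
    by (simp add: bij_betw_def endo_inj_surj)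
  moreover have "signed n \<tau> N i = i" if "i \<notin> ?S" for i
    using that by (auto simp: signed_def)
  ultimately have "signed n \<tau> N permutes ?S" by (rule bij_imp_permutes)
  thus ?thesis by (simp add: signed_perms_def signed_uminus)
qed

lemma sum_signed_perms:
  "(\<Sum>\<pi>\<in>signed_perms n. f \<pi>) =
   (\<Sum>\<tau> | \<tau> permutes {1..n}. \<Sum>N\<in>Pow {1..n}. f (signed n \<tau> N))"
proof -
  define absp where "absp = (\<lambda>(\<pi>::int \<Rightarrow> int) j. nat \<bar>\<pi> (int j)\<bar>)"
  \<comment> \<open>The factor \<open>(- 1) ^ j\<close> makes \<open>negs\<close> record the signs
    of the alternated sequence, not those of \<open>\<pi>\<close>.\<close>
  define negs where "negs = (\<lambda>(\<pi>::int \<Rightarrow> int). {j \<in> {1..n}. (- 1) ^ j * \<pi> (int j) < 0})"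
  have inv: "signed n (absp \<pi>) (negs \<pi>) = \<pi>" if "\<pi> \<in> signed_perms n" for \<pi>
  proof
    fix i
    have perm: "\<pi> permutes {- int n..int n} - {0}" and odd: "\<And>i. \<pi> (- i) = - \<pi> i"
      using that by (auto simp: signed_perms_def)
    show "signed n (absp \<pi>) (negs \<pi>) i = \<pi> i"
    proof (cases "nat \<bar>i\<bar> \<in> {1..n}")
      case False
      hence "i \<notin> {- int n..int n} - {0}" by auto
      thus ?thesis using False permutes_not_in[OF perm, of i] unfolding signed_def by (simp only: if_False not_False_eq_True)
    next
      case True
      have pos: "signed n (absp \<pi>) (negs \<pi>) (int j) = \<pi> (int j)" if "j \<in> {1..n}" for j
        using that by (cases "even j") (auto simp: signed_def absp_def negs_def)
      show ?thesis
      proof (cases "i \<ge> 0")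
        case True
        thus ?thesis using pos[of "nat i"] \<open>nat \<bar>i\<bar> \<in> {1..n}\<close> by simp
      next
        case False
        thus ?thesis using pos[of "nat (- i)"] \<open>nat \<bar>i\<bar> \<in> {1..n}\<close>
          signed_uminus[of n "absp \<pi>" "negs \<pi>" i] odd[of i] by simp
      qed
    qed
  qed
  have "(\<Sum>\<pi>\<in>signed_perms n. f \<pi>) =
        (\<Sum>(\<tau>, N)\<in>{\<tau>. \<tau> permutes {1..n}} \<times> Pow {1..n}. f (signed n \<tau> N))"
  proof (rule sum.reindex_bij_witness[where i = "\<lambda>(\<tau>, N). signed n \<tau> N" and j = "\<lambda>\<pi>. (absp \<pi>, negs \<pi>)"], goal_cases)
    case (1 \<pi>)
    thus ?case by (simp add: inv)
  next
    case (2 \<pi>)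
    hence perm: "\<pi> permutes {- int n..int n} - {0}" and odd: "\<And>i. \<pi> (- i) = - \<pi> i"
      by (auto simp: signed_perms_def)
    have inj: "inj (absp \<pi>)"
    proof (rule injI)
      fix i j assume "absp \<pi> i = absp \<pi> j"
      hence "\<pi> (int i) = \<pi> (int j) \<or> \<pi> (int i) = \<pi> (- int j)"
        by (auto simp: absp_def odd abs_if split: if_splits)
      hence "int i = int j \<or> int i = - int j"
        by (simp only: inj_eq[OF permutes_inj[OF perm]])
      thus "i = j" by linarith
    qed
    have "absp \<pi> j \<in> {1..n}" if "j \<in> {1..n}" for j
    proof -
      have "\<pi> (int j) \<in> {- int n..int n} - {0}"
        using permutes_in_image[OF perm, of "int j"] that by simp
      thus ?thesis by (auto simp: absp_def)
    qed
    hence "absp \<pi> ` {1..n} \<subseteq> {1..n}" by blast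
    hence "bij_betw (absp \<pi>) {1..n} {1..n}"
      using inj_on_subset[OF inj subset_UNIV]
      by (simp add: bij_betw_def endo_inj_surj)
    moreover have "absp \<pi> j = j" if "j \<notin> {1..n}" for j
    proof -
      have "\<pi> (int j) = int j" using permutes_not_in[OF perm, of "int j"] that by auto
      thus ?thesis by (simp add: absp_def)
    qed
    ultimately have "absp \<pi> permutes {1..n}" by (rule bij_imp_permutes)
    thus ?case by (auto simp: negs_def)
  next
    case (3 \<tau>N)
    then obtain \<tau> N where [simp]: "\<tau>N = (\<tau>, N)" and \<tau>: "\<tau> permutes {1..n}" and N: "N \<subseteq> {1..n}"
      by auto
    have "absp (signed n \<tau> N) = \<tau>"
      by (auto simp: absp_def abs_signed[OF \<tau>])
    moreover have "j \<in> negs (signed n \<tau> N) \<longleftrightarrow> j \<in> N" for j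
      using N permutes_pos[OF \<tau>, of j]
      by (cases "even j") (auto simp: negs_def signed_def)
    ultimately show ?case by auto
  next
    case (4 \<tau>N)
    thus ?case by (auto intro: signed_in_signed_perms)
  next
    case (5 \<pi>)
    thus ?case by (simp add: inv)
  qed
  thus ?thesis by (simp add: sum.cartesian_product)
qed

text \<open>Double counting: each pair of neighbours \<open>i\<close>, \<open>i + 1\<close> with
  different values is charged to the position of its larger value.\<close>

lemma sum_up_count:
  fixes \<tau> :: "nat \<Rightarrow> nat"
  assumes "N \<subseteq> {1..n}"
  shows "(\<Sum>j\<in>N. up_count n \<tau> j) =
    (\<Sum>i<n. of_bool (\<tau> i < \<tau> (i + 1) \<and> i + 1 \<in> N) + of_bool (\<tau> (i + 1) < \<tau> i \<and> i \<in> N))"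
proof -
  have "(\<Sum>j\<in>N. up_count n \<tau> j) = (\<Sum>j\<in>{1..n}. if j \<in> N then up_count n \<tau> j else 0)"
    using assms by (intro sum.mono_neutral_cong_left) auto
  also have "\<dots> = (\<Sum>j=1..n. of_bool (\<tau> (j - 1) < \<tau> j \<and> j \<in> N)) +
      (\<Sum>j=1..n. of_bool (j < n \<and> \<tau> (j + 1) < \<tau> j \<and> j \<in> N))"
    unfolding sum.distrib [symmetric] by (intro sum.cong) (auto simp: up_count_def)
  also have "(\<Sum>j=1..n. of_bool (\<tau> (j - 1) < \<tau> j \<and> j \<in> N)) =
      (\<Sum>i<n. of_bool (\<tau> i < \<tau> (i + 1) \<and> i + 1 \<in> N) :: nat)"
    by (rule sum.reindex_bij_witness[where i = Suc and j = "\<lambda>j. j - 1"]) auto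
  also have "(\<Sum>j=1..n. of_bool (j < n \<and> \<tau> (j + 1) < \<tau> j \<and> j \<in> N)) =
      (\<Sum>i<n. of_bool (\<tau> (i + 1) < \<tau> i \<and> i \<in> N) :: nat)"
    using assms by (intro sum.mono_neutral_cong) auto
  finally show ?thesis by (simp add: sum.distrib)
qed

lemma altdes_B_signed:
  assumes \<tau>: "\<tau> permutes {1..n}" and N: "N \<subseteq> {1..n}"
  shows "altdes_B n (signed n \<tau> N) = (\<Sum>j\<in>N. up_count n \<tau> j)"
proof -
  let ?\<pi> = "signed n \<tau> N"
  let ?P = "\<lambda>i. if \<tau> i < \<tau> (i + 1) then i + 1 \<in> N else i \<in> N"
  \<comment> \<open>This includes \<open>j = 0\<close> because \<open>\<tau> 0 = 0\<close>, so the
    pair \<open>0\<close>, \<open>1\<close> needs no separate treatment.\<close>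
  have val: "?\<pi> (int j) = (- 1) ^ j * (if j \<in> N then - 1 else 1) * int (\<tau> j)" if "j \<le> n" for j
    using that permutes_zero[OF \<tau>] by (cases "j = 0") (auto simp: signed_def)
  have neq: "\<tau> i \<noteq> \<tau> (i + 1)" for i
    using permutes_inj[OF \<tau>] by (simp add: inj_eq)
  \<comment> \<open>The signs attached to \<open>i\<close> and \<open>i + 1\<close> by the
    alternation are opposite, so the comparison is decided by the sign of the larger absolute value;
    for odd \<open>i\<close> both the signs and the inequality are reversed.\<close>
  have even_step: "?\<pi> (int i) < ?\<pi> (int (i + 1)) \<longleftrightarrow> ?P i" if "i < n" "even i" for i
    using that neq[of i] by (subst (1 2) val) auto
  have odd_step: "?\<pi> (int i) > ?\<pi> (int (i + 1)) \<longleftrightarrow> ?P i" if "i < n" "odd i" for i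
    using that neq[of i] by (subst (1 2) val) auto
  have "{2 * i | i. 2 * i + 1 \<le> n \<and> ?\<pi> (int (2 * i)) < ?\<pi> (int (2 * i + 1))} = {i. i < n \<and> even i \<and> ?P i}"
    (is "?L = _")
  proof -
    have "?L = {i. i < n \<and> even i \<and> ?\<pi> (int i) < ?\<pi> (int (i + 1))}"
      by (auto elim!: evenE)
    also have "\<dots> = {i. i < n \<and> even i \<and> ?P i}"
      by (intro Collect_cong conj_cong refl even_step)
    finally show ?thesis .
  qed
  moreover have "{2 * i + 1 | i. 2 * i + 2 \<le> n \<and> ?\<pi> (int (2 * i + 1)) > ?\<pi> (int (2 * i + 2))} = {i. i < n \<and> odd i \<and> ?P i}"
    (is "?L = _")
  proof -
    have "?L = {i. i < n \<and> odd i \<and> ?\<pi> (int i) > ?\<pi> (int (i + 1))}"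
      by (auto elim!: oddE simp: add_ac)
    also have "\<dots> = {i. i < n \<and> odd i \<and> ?P i}"
      by (intro Collect_cong conj_cong refl odd_step)
    finally show ?thesis .
  qed
  moreover have "{i. i < n \<and> even i \<and> ?P i} \<union> {i. i < n \<and> odd i \<and> ?P i} = {i. i < n \<and> ?P i}"
    by auto
  ultimately have "altdes_B n ?\<pi> = card {i. i < n \<and> ?P i}"
    unfolding altdes_B_def by (simp only:)
  also have "\<dots> = (\<Sum>i<n. of_bool (?P i))"
    by (subst sum_of_bool_eq) (auto intro!: arg_cong[where f = card])
  also have "\<dots> = (\<Sum>i<n. of_bool (\<tau> i < \<tau> (i + 1) \<and> i + 1 \<in> N) + of_bool (\<tau> (i + 1) < \<tau> i \<and> i \<in> N))"
    using neq neq[symmetric] by (intro sum.cong) (auto simp: not_less le_less)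
  finally show ?thesis by (simp add: sum_up_count[OF N])
qed

lemma left_peaks_eq:
  "left_peaks n \<tau> = {j \<in> {1..n}. up_count n \<tau> j = 2}"
  by (auto simp: left_peaks_def up_count_def split: if_splits)

text \<open>Each of the \<open>n\<close> pairs of neighbours is charged once, so the counts, which
  lie in \<open>{0, 1, 2}\<close>, sum to \<open>n\<close>. Hence \<open>0\<close> occurs as often
  as \<open>2\<close>, namely \<open>p\<close> times, and each such couple contributes
  \<open>2 * (1 + x^2)\<close>.\<close>

lemma prod_up_count:
  fixes x :: "'a :: comm_semiring_1"
  assumes \<tau>: "\<tau> permutes {1..n}"
  defines "p \<equiv> card (left_peaks n \<tau>)"
  shows "(\<Prod>j=1..n. 1 + x ^ up_count n \<tau> j) = (2 * (1 + x\<^sup>2)) ^ p * (1 + x) ^ (n - 2 * p)"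
    and "2 * p \<le> n"
proof -
  let ?c = "up_count n \<tau>"
  let ?C = "\<lambda>k. {j \<in> {1..n}. ?c j = k}"
  have le2: "?c j \<in> {0, 1, 2}" for j by (auto simp: up_count_def)
  have p: "card (?C 2) = p" by (simp add: p_def left_peaks_eq)
  have neq: "\<tau> i \<noteq> \<tau> (i + 1)" for i
    using permutes_inj[OF \<tau>] by (simp add: inj_eq)
  have "(\<Sum>j=1..n. ?c j) = (\<Sum>i<n. of_bool (\<tau> i < \<tau> (i + 1) \<and> i + 1 \<in> {1..n}) + of_bool (\<tau> (i + 1) < \<tau> i \<and> i \<in> {1..n}))"
    by (rule sum_up_count) simp
  also have "\<dots> = (\<Sum>i<n. 1)"
  proof (intro sum.cong refl)
    fix i assume "i \<in> {..<n}"
    thus "of_bool (\<tau> i < \<tau> (i + 1) \<and> i + 1 \<in> {1..n}) + of_bool (\<tau> (i + 1) < \<tau> i \<and> i \<in> {1..n}) = (1::nat)"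
      using neq[of i] permutes_zero[OF \<tau>] by (cases "i = 0") auto
  qed
  finally have sum: "(\<Sum>j=1..n. ?c j) = n" by simp
  have "(\<Sum>j=1..n. ?c j) = (\<Sum>j=1..n. of_bool (?c j = 1) + 2 * of_bool (?c j = 2))"
    using le2 by (intro sum.cong refl) force
  hence s1: "card (?C 1) + 2 * p = n"
    using sum p by (simp add: sum.distrib sum_distrib_left[symmetric] sum_of_bool_eq Int_def)
  have "(\<Sum>j=1..n. 1 :: nat) = (\<Sum>j=1..n. of_bool (?c j = 0) + of_bool (?c j = 1) + of_bool (?c j = 2))"
    using le2 by (intro sum.cong refl) force
  hence s0: "card (?C 0) + card (?C 1) + p = n"
    using p by (simp add: sum.distrib sum_of_bool_eq Int_def)
  have "(\<Prod>j=1..n. 1 + x ^ ?c j) = (\<Prod>j=1..n. (if ?c j = 0 then 2 else 1) * (if ?c j = 1 then 1 + x else 1) *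
      (if ?c j = 2 then 1 + x\<^sup>2 else 1))"
    using le2 by (intro prod.cong refl) force
  also have "\<dots> = 2 ^ card (?C 0) * (1 + x) ^ card (?C 1) * (1 + x\<^sup>2) ^ card (?C 2)"
    by (simp add: prod.distrib prod.inter_filter [symmetric])
  also have "\<dots> = (2 * (1 + x\<^sup>2)) ^ p * (1 + x) ^ (n - 2 * p)"
  proof -
    have "card (?C 0) = p" "card (?C 1) = n - 2 * p" using s0 s1 by simp_all
    thus ?thesis using p by (simp only: power_mult_distrib mult_ac)
  qed
  finally show "(\<Prod>j=1..n. 1 + x ^ up_count n \<tau> j) = (2 * (1 + x\<^sup>2)) ^ p * (1 + x) ^ (n - 2 * p)" .
  show "2 * p \<le> n" using s1 by simp
qed

abbreviation peaks :: "nat \<Rightarrow> (nat \<Rightarrow> nat) \<Rightarrow> nat" where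
  "peaks n \<tau> \<equiv> card (left_peaks n \<tau>)"

lemma two_peaks_le: "\<tau> \<in> {\<tau>. \<tau> permutes {1..n}} \<Longrightarrow> 2 * peaks n \<tau> \<le> n"
  using prod_up_count(2) by simp

text \<open>For fixed \<open>\<tau>\<close> the statistic is additive over \<open>N\<close>, so the
  sum over all sign sets is the expansion of a product in which every position chooses its sign
  independently.\<close>

lemma alt_eulerian_B_peaks:
  "alt_eulerian_B n = (\<Sum>\<tau> | \<tau> permutes {1..n}.
     (2 * [:1, 0, 1:]) ^ peaks n \<tau> * [:1, 1:] ^ (n - 2 * peaks n \<tau>))"
proof -
  let ?x = "[:0, 1:] :: real poly"
  have X: "1 + ?x\<^sup>2 = [:1, 0, 1:]" "1 + ?x = [:1, 1:]"
    by (simp_all add: power2_eq_square one_pCons)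
  have "alt_eulerian_B n = (\<Sum>\<tau> | \<tau> permutes {1..n}. \<Sum>N\<in>Pow {1..n}. monom 1 (altdes_B n (signed n \<tau> N)))"
    unfolding alt_eulerian_B_def by (rule sum_signed_perms)
  also have "\<dots> = (\<Sum>\<tau> | \<tau> permutes {1..n}. \<Prod>j=1..n. 1 + ?x ^ up_count n \<tau> j)"
  proof (intro sum.cong refl)
    fix \<tau> assume "\<tau> \<in> {\<tau>. \<tau> permutes {1..n}}"
    hence \<tau>: "\<tau> permutes {1..n}" by simp
    have "(\<Sum>N\<in>Pow {1..n}. monom 1 (altdes_B n (signed n \<tau> N))) =
          (\<Sum>N\<in>Pow {1..n}. (\<Prod>j\<in>N. ?x ^ up_count n \<tau> j) * (\<Prod>j\<in>{1..n} - N. 1))"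
      by (intro sum.cong refl) (auto simp: altdes_B_signed[OF \<tau>] monom_altdef power_sum)
    also have "\<dots> = (\<Prod>j=1..n. ?x ^ up_count n \<tau> j + 1)"
      by (subst prod_add) simp_all
    finally show "(\<Sum>N\<in>Pow {1..n}. monom 1 (altdes_B n (signed n \<tau> N))) =
        (\<Prod>j=1..n. 1 + ?x ^ up_count n \<tau> j)" by (simp only: add.commute)
  qed
  also have "\<dots> = (\<Sum>\<tau> | \<tau> permutes {1..n}. (2 * [:1, 0, 1:]) ^ peaks n \<tau> * [:1, 1:] ^ (n - 2 * peaks n \<tau>))"
    by (intro sum.cong refl) (simp only: mem_Collect_eq prod_up_count(1) X)
  finally show ?thesis .
qed

section \<open>Insertion of the maximum\<close>

definition insert_max :: "nat \<Rightarrow> nat \<Rightarrow> (nat \<Rightarrow> nat) \<Rightarrow> nat \<Rightarrow> nat" where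
  "insert_max n k \<tau> i =
     (if i < k then \<tau> i else if i = k then Suc n else if i \<le> Suc n then \<tau> (i - 1) else i)"

lemma insert_max_permutes:
  assumes \<tau>: "\<tau> permutes {1..n}" and k: "k \<in> {1..Suc n}"
  shows "insert_max n k \<tau> permutes {1..Suc n}"
proof -
  have img: "\<tau> i \<in> {1..n} \<longleftrightarrow> i \<in> {1..n}" for i
    by (rule permutes_in_image[OF \<tau>])
  have inj: "\<tau> i = \<tau> j \<longleftrightarrow> i = j" for i j
    using permutes_inj[OF \<tau>] by (rule inj_eq)
  have le: "1 \<le> \<tau> i \<and> \<tau> i \<le> n" if "1 \<le> i" "i \<le> n" for i
    using img[of i] that by simp
  have "inj_on (insert_max n k \<tau>) {1..Suc n}"
  proof (rule inj_onI)
    fix i j assume ij: "i \<in> {1..Suc n}" "j \<in> {1..Suc n}" "insert_max n k \<tau> i = insert_max n k \<tau> j"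
    have *: "insert_max n k \<tau> i = (if i = k then Suc n else \<tau> (if i < k then i else i - 1))"
      if "i \<in> {1..Suc n}" for i
      using that by (auto simp: insert_max_def)
    have "\<tau> (if i < k then i else i - 1) < Suc n" if "i \<in> {1..Suc n}" "i \<noteq> k" for i
    proof -
      have "1 \<le> (if i < k then i else i - 1)" "(if i < k then i else i - 1) \<le> n"
        using that k by auto
      thus ?thesis using le by (simp add: less_Suc_eq_le)
    qed
    hence "i = k \<longleftrightarrow> j = k"
      using ij by (metis * less_irrefl)
    thus "i = j"
      using ij k by (auto simp: * inj split: if_splits)
  qed
  moreover have "insert_max n k \<tau> ` {1..Suc n} \<subseteq> {1..Suc n}"
  proof (rule image_subsetI)
    fix i assume "i \<in> {1..Suc n}"
    thus "insert_max n k \<tau> i \<in> {1..Suc n}"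
      using le[of i] le[of "i - 1"] k by (cases "i \<le> k") (auto simp: insert_max_def le_SucI)
  qed
  ultimately have "bij_betw (insert_max n k \<tau>) {1..Suc n} {1..Suc n}"
    by (simp only: bij_betw_def endo_inj_surj finite_atLeastAtMost simp_thms)
  moreover have "insert_max n k \<tau> i = i" if "i \<notin> {1..Suc n}" for i
    using that k permutes_zero[OF \<tau>] by (auto simp: insert_max_def not_le)
  ultimately show ?thesis by (rule bij_imp_permutes)
qed

lemma insert_max_inj:
  "inj_on (\<lambda>(\<tau>, k). insert_max n k \<tau>) ({\<tau>. \<tau> permutes {1..n}} \<times> {1..Suc n})"
proof (rule inj_onI, clarify)
  fix \<tau> k \<tau>' k'
  assume \<tau>: "\<tau> permutes {1..n}" and k: "k \<in> {1..Suc n}"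
    and \<tau>': "\<tau>' permutes {1..n}" and k': "k' \<in> {1..Suc n}"
    and eq: "insert_max n k \<tau> = insert_max n k' \<tau>'"
  have "insert_max n k \<tau> k = Suc n" "insert_max n k' \<tau>' k' = Suc n"
    by (simp_all add: insert_max_def)
  hence kk: "k = k'"
    using eq permutes_inj[OF insert_max_permutes[OF \<tau> k]] by (metis inj_eq)
  have "\<tau> i = \<tau>' i" for i
  proof (cases "i \<in> {1..n}")
    case False
    thus ?thesis using permutes_not_in[OF \<tau>] permutes_not_in[OF \<tau>'] by simp
  next
    case True
    show ?thesis
    proof (cases "i < k")
      case True
      thus ?thesis using fun_cong[OF eq, of i] kk by (simp add: insert_max_def)
    next
      case False
      thus ?thesis using fun_cong[OF eq, of "Suc i"] kk \<open>i \<in> {1..n}\<close> by (simp add: insert_max_def)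
    qed
  qed
  thus "\<tau> = \<tau>' \<and> k = k'" using kk by blast
qed

lemma sum_permutes_insert_max:
  "(\<Sum>\<tau> | \<tau> permutes {1..Suc n}. f \<tau>) =
   (\<Sum>\<tau> | \<tau> permutes {1..n}. \<Sum>k=1..Suc n. f (insert_max n k \<tau>))"
proof -
  let ?ins = "\<lambda>(\<tau>, k). insert_max n k \<tau>"
  let ?A = "{\<tau>. \<tau> permutes {1..n}} \<times> {1..Suc n}"
  \<comment> \<open>Surjectivity follows by counting, from \<open>(n + 1) * n! = (n + 1)!\<close>,
    instead of from an inverse that deletes the maximum.\<close>
  have "?ins ` ?A = {\<tau>. \<tau> permutes {1..Suc n}}"
  proof (rule card_subset_eq)
    show "?ins ` ?A \<subseteq> {\<tau>. \<tau> permutes {1..Suc n}}"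
      using insert_max_permutes by auto
    show "card (?ins ` ?A) = card {\<tau>. \<tau> permutes {1..Suc n}}"
      by (subst card_image[OF insert_max_inj])
        (simp add: card_cartesian_product card_permutations[OF refl])
  qed (simp add: finite_permutations)
  hence "(\<Sum>\<tau> | \<tau> permutes {1..Suc n}. f \<tau>) = (\<Sum>(\<tau>, k)\<in>?A. f (insert_max n k \<tau>))"
    using sum.reindex[OF insert_max_inj[of n], of f] by (simp add: case_prod_unfold)
  thus ?thesis by (simp only: sum.cartesian_product)
qed

text \<open>The new maximum is a left peak unless it comes last, and it destroys peaks at the old
  positions \<open>k - 1\<close> and \<open>k\<close>, which become its neighbours. All other peaks
  survive, shifted by one to the right of it.\<close>

lemma left_peaks_insert_max:
  assumes "\<tau> permutes {1..n}" and k: "k \<in> {1..Suc n}"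
  shows "left_peaks (Suc n) (insert_max n k \<tau>) =
    {i \<in> left_peaks n \<tau>. i < k - 1} \<union> (if k \<le> n then {k} else {}) \<union> Suc ` {i \<in> left_peaks n \<tau>. k < i}"
    (is "_ = ?R")
proof (intro set_eqI)
  fix i
  have le: "\<tau> j \<le> n" if "j \<le> n" for j
    using permutes_in_image[OF assms(1), of j] permutes_zero[OF assms(1)] that by (cases "j = 0") auto
  consider "i + 1 < k" | "i + 1 = k" | "i = k" | "i = k + 1" | "k + 1 < i"
    by linarith
  thus "i \<in> left_peaks (Suc n) (insert_max n k \<tau>) \<longleftrightarrow> i \<in> ?R"
  proof cases
    case 1
    thus ?thesis using k by (auto simp: left_peaks_def insert_max_def)
  next
    case 2
    thus ?thesis using k le[of i] by (auto simp: left_peaks_def insert_max_def)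
  next
    case 3
    thus ?thesis using k le[of "k - 1"] le[of k]
      by (auto simp: left_peaks_def insert_max_def less_Suc_eq_le)
  next
    case 4
    thus ?thesis using k le[of k] by (auto simp: left_peaks_def insert_max_def)
  next
    case 5
    then obtain j where "i = Suc j" "k < j" by (cases i) auto
    thus ?thesis using k by (auto simp: left_peaks_def insert_max_def)
  qed
qed

lemma left_peaks_not_adjacent: "i \<in> left_peaks n \<tau> \<Longrightarrow> Suc i \<notin> left_peaks n \<tau>"
  by (auto simp: left_peaks_def)

lemma left_peaks_subset: "left_peaks n \<tau> \<subseteq> {1..n - 1}"
  by (auto simp: left_peaks_def)

lemma finite_left_peaks [simp]: "finite (left_peaks n \<tau>)"
  by (simp add: left_peaks_def)

text \<open>Left peaks are never adjacent, so at most one of the old positions \<open>k - 1\<close>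
  and \<open>k\<close> is a peak. If one is, the new peak merely replaces it.\<close>

lemma peaks_insert_max:
  assumes \<tau>: "\<tau> permutes {1..n}" and k: "k \<in> {1..Suc n}"
  shows "peaks (Suc n) (insert_max n k \<tau>) =
    (if k = Suc n \<or> k \<in> left_peaks n \<tau> \<union> Suc ` left_peaks n \<tau> then peaks n \<tau> else Suc (peaks n \<tau>))"
proof -
  let ?P = "left_peaks n \<tau>"
  let ?L = "{i \<in> ?P. i < k - 1}" and ?U = "{i \<in> ?P. k < i}" and ?M = "{i \<in> ?P. i = k - 1 \<or> i = k}"
  have "card (left_peaks (Suc n) (insert_max n k \<tau>)) = card ?L + of_bool (k \<le> n) + card ?U"
    unfolding left_peaks_insert_max[OF \<tau> k]
    by (subst card_Un_disjoint) (auto simp: card_Un_disjoint card_image card_insert_if)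
  moreover have "card ?P = card ?L + card ?M + card ?U"
  proof -
    have "?P = ?L \<union> ?M \<union> ?U" by auto
    hence "card ?P = card (?L \<union> ?M \<union> ?U)" by (rule arg_cong)
    also have "\<dots> = card (?L \<union> ?M) + card ?U" by (rule card_Un_disjoint) auto
    also have "card (?L \<union> ?M) = card ?L + card ?M" by (rule card_Un_disjoint) auto
    finally show ?thesis .
  qed
  moreover have "card ?M = of_bool (k \<in> ?P \<union> Suc ` ?P)"
  proof -
    have "k \<in> Suc ` ?P \<longleftrightarrow> k - 1 \<in> ?P"
      using k by (auto simp: image_iff intro: bexI[of _ "k - 1"])
    moreover have "?M = (if k \<in> ?P then {k} else if k - 1 \<in> ?P then {k - 1} else {})"
      using left_peaks_not_adjacent[of "k - 1" n \<tau>] k by auto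
    ultimately show ?thesis by simp
  qed
  moreover have "Suc n \<notin> ?P \<union> Suc ` ?P"
    by (auto simp: left_peaks_def)
  ultimately show ?thesis using k by (cases "k = Suc n") (simp_all add: of_bool_def)
qed

text \<open>Leaving the weight \<open>h\<close> arbitrary lets one insertion argument yield the
  recurrences of both polynomial sequences. The \<open>2 p + 1\<close> neutral positions are the
  peaks, their successors and the end.\<close>

lemma sum_peaks_Suc:
  fixes h :: "nat \<Rightarrow> 'a :: comm_ring_1"
  shows "(\<Sum>\<tau> | \<tau> permutes {1..Suc n}. h (peaks (Suc n) \<tau>)) =
    (\<Sum>\<tau> | \<tau> permutes {1..n}. of_nat (2 * peaks n \<tau> + 1) * h (peaks n \<tau>) +
       of_nat (n - 2 * peaks n \<tau>) * h (Suc (peaks n \<tau>)))"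
  unfolding sum_permutes_insert_max
proof (intro sum.cong refl)
  fix \<tau> assume "\<tau> \<in> {\<tau>. \<tau> permutes {1..n}}"
  hence \<tau>: "\<tau> permutes {1..n}" by simp
  let ?P = "left_peaks n \<tau>" and ?p = "peaks n \<tau>"
  let ?S = "insert (Suc n) (?P \<union> Suc ` ?P)"
  have sub: "?S \<subseteq> {1..Suc n}" using left_peaks_subset[of n \<tau>] by fastforce
  have "?P \<inter> Suc ` ?P = {}" using left_peaks_not_adjacent by fastforce
  hence "card (?P \<union> Suc ` ?P) = 2 * ?p"
    by (subst card_Un_disjoint) (auto simp: card_image)
  moreover have "Suc n \<notin> ?P \<union> Suc ` ?P" using left_peaks_subset[of n \<tau>] by fastforce
  ultimately have card: "card ?S = 2 * ?p + 1" by simp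
  let ?h = "\<lambda>k. h (peaks (Suc n) (insert_max n k \<tau>))"
  have val: "?h k = (if k \<in> ?S then h ?p else h (Suc ?p))" if "k \<in> {1..Suc n}" for k
    by (subst peaks_insert_max[OF \<tau> that]) auto
  have "(\<Sum>k=1..Suc n. ?h k) = (\<Sum>k\<in>{1..Suc n} - ?S. ?h k) + (\<Sum>k\<in>?S. ?h k)"
    by (rule sum.subset_diff[OF sub]) simp
  also have "(\<Sum>k\<in>?S. ?h k) = (\<Sum>k\<in>?S. h ?p)"
    using sub by (intro sum.cong refl) (subst val; auto)
  also have "(\<Sum>k\<in>{1..Suc n} - ?S. ?h k) = (\<Sum>k\<in>{1..Suc n} - ?S. h (Suc ?p))"
    by (intro sum.cong refl) (subst val; auto)
  also have "(\<Sum>k\<in>{1..Suc n} - ?S. h (Suc ?p)) = of_nat (n - 2 * ?p) * h (Suc ?p)"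
  proof -
    have "card ({1..Suc n} - ?S) = n - 2 * ?p"
      by (subst card_Diff_subset[OF _ sub]) (simp_all add: card[simplified])
    thus ?thesis by (simp only: sum_constant)
  qed
  also have "(\<Sum>k\<in>?S. h ?p) = of_nat (2 * ?p + 1) * h ?p"
    using card by (simp only: sum_constant)
  finally show "(\<Sum>k=1..Suc n. h (peaks (Suc n) (insert_max n k \<tau>))) =
    of_nat (2 * ?p + 1) * h ?p + of_nat (n - 2 * ?p) * h (Suc ?p)"
    by (simp only: add.commute)
qed

lemma Q1_peaks:
  "Q1 n = (\<Sum>\<tau> | \<tau> permutes {1..n}. [:1, 0, 1:] ^ peaks n \<tau> * [:0, 1:] ^ (n - 2 * peaks n \<tau>))"
proof (induction n)
  case 0
  show ?case by (simp add: left_peaks_def)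
next
  case (Suc n)
  let ?u = "[:1, 0, 1:] :: real poly" and ?x = "[:0, 1:] :: real poly"
  have "Q1 (Suc n) = (\<Sum>\<tau> | \<tau> permutes {1..n}.
      ?x * (?u ^ peaks n \<tau> * ?x ^ (n - 2 * peaks n \<tau>)) +
      ?u * pderiv (?u ^ peaks n \<tau> * ?x ^ (n - 2 * peaks n \<tau>)))"
    by (simp add: Suc sum.distrib sum_distrib_left higher_pderiv_sum[of 1, simplified])
  also have "\<dots> = (\<Sum>\<tau> | \<tau> permutes {1..n}.
      of_nat (2 * peaks n \<tau> + 1) * (?u ^ peaks n \<tau> * ?x ^ (Suc n - 2 * peaks n \<tau>)) +
      of_nat (n - 2 * peaks n \<tau>) * (?u ^ Suc (peaks n \<tau>) * ?x ^ (Suc n - 2 * Suc (peaks n \<tau>))))"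
  proof (intro sum.cong refl)
    fix \<tau> assume "\<tau> \<in> {\<tau>. \<tau> permutes {1..n}}"
    hence "2 * peaks n \<tau> \<le> n" by (rule two_peaks_le)
    then obtain m where n: "n = 2 * peaks n \<tau> + m" using le_Suc_ex by blast
    let ?p = "peaks n \<tau>"
    have du: "pderiv (?u ^ p) = of_nat p * (2 * ?x) * ?u ^ (p - 1)" for p
      by (simp add: pderiv_power pderiv_pCons of_nat_poly numeral_poly mult.commute)
    have dx: "pderiv (?x ^ m) = of_nat m * ?x ^ (m - 1)" for m
      by (simp add: pderiv_power pderiv_pCons of_nat_poly)
    \<comment> \<open>Variables \<open>x\<close> and \<open>u\<close> keep the simplifier from
      multiplying out concrete polynomials; the case splits handle the truncated exponents
      \<open>p - 1\<close> and \<open>m - 1\<close>.\<close>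
    have alg: "x * (u ^ p * x ^ m) + u * (u ^ p * (of_nat m * x ^ (m - 1)) + x ^ m * (of_nat p * (2 * x) * u ^ (p - 1))) =
       of_nat (2 * p + 1) * (u ^ p * x ^ Suc m) + of_nat m * (u ^ Suc p * x ^ (m - 1))"
      for p :: nat and x u :: "real poly"
      by (cases p; cases m) (simp_all add: algebra_simps)
    have "?x * (?u ^ ?p * ?x ^ m) + ?u * pderiv (?u ^ ?p * ?x ^ m) =
       of_nat (2 * ?p + 1) * (?u ^ ?p * ?x ^ Suc m) + of_nat m * (?u ^ Suc ?p * ?x ^ (m - 1))"
      unfolding pderiv_mult du dx by (rule alg)
    moreover have "n - 2 * ?p = m" "Suc n - 2 * ?p = Suc m" "Suc n - 2 * Suc ?p = m - 1"
      using n by simp_all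
    ultimately show "?x * (?u ^ ?p * ?x ^ (n - 2 * ?p)) + ?u * pderiv (?u ^ ?p * ?x ^ (n - 2 * ?p)) =
      of_nat (2 * ?p + 1) * (?u ^ ?p * ?x ^ (Suc n - 2 * ?p)) +
      of_nat (n - 2 * ?p) * (?u ^ Suc ?p * ?x ^ (Suc n - 2 * Suc ?p))"
      by (simp only:)
  qed
  also have "\<dots> = (\<Sum>\<tau> | \<tau> permutes {1..Suc n}. ?u ^ peaks (Suc n) \<tau> * ?x ^ (Suc n - 2 * peaks (Suc n) \<tau>))"
    by (rule sum_peaks_Suc[where h = "\<lambda>p. ?u ^ p * ?x ^ (Suc n - 2 * p)", symmetric])
  finally show ?case .
qed

section \<open>Relation between the two polynomial sequences\<close>

text \<open>Real polynomials are evaluated below in rational functions, in complex numbers and in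
  formal power series. The last do not form a field, hence the split into a ring and a field
  version.\<close>

locale real_hom =
  fixes h :: "real \<Rightarrow> 'a :: comm_ring_1"
  assumes hom_0 [simp]: "h 0 = 0" and hom_1 [simp]: "h 1 = 1"
    and hom_add: "h (a + b) = h a + h b" and hom_mult: "h (a * b) = h a * h b"
begin

definition ev :: "real poly \<Rightarrow> 'a \<Rightarrow> 'a" where
  "ev p y = poly (map_poly h p) y"

lemma ev_pCons [simp]: "ev (pCons a p) y = h a + y * ev p y"
  by (simp add: ev_def map_poly_pCons)

lemma ev_0 [simp]: "ev 0 y = 0"
  by (simp add: ev_def)

lemma ev_1 [simp]: "ev 1 y = 1"
  by (simp add: one_pCons)

lemma ev_add [simp]: "ev (p + q) y = ev p y + ev q y"
  by (induction p q rule: poly_induct2) (simp_all add: hom_add algebra_simps)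

lemma ev_smult [simp]: "ev (smult a p) y = h a * ev p y"
  by (induction p) (simp_all add: hom_mult algebra_simps)

lemma ev_mult [simp]: "ev (p * q) y = ev p y * ev q y"
  by (induction p) (simp_all add: algebra_simps)

lemma ev_power [simp]: "ev (p ^ n) y = ev p y ^ n"
  by (induction n) simp_all

lemma ev_sum [simp]: "ev (sum f A) y = (\<Sum>a\<in>A. ev (f a) y)"
  by (induction A rule: infinite_finite_induct) simp_all

lemma ev_of_nat [simp]: "ev (of_nat n) y = of_nat n"
  by (induction n) simp_all

lemma ev_numeral [simp]: "ev (numeral n) y = numeral n"
  using ev_of_nat[of "numeral n" y] by simp

end

locale real_field_hom = real_hom h for h :: "real \<Rightarrow> 'a :: field_char_0"
begin

text \<open>The two sums agree term by term: with \<open>y = (1 + z) / (1 - z)\<close> one has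
  \<open>1 + z = (1 - z) * y\<close> and \<open>2 * (1 + z^2) = (1 - z)^2 * (1 + y^2)\<close>, and
  the powers of \<open>1 - z\<close> in a term add up to \<open>n\<close>.\<close>

lemma ev_alt_eulerian_B:
  assumes "z \<noteq> 1"
  shows "ev (alt_eulerian_B n) z = (1 - z) ^ n * ev (Q1 n) ((1 + z) / (1 - z))"
proof -
  let ?y = "(1 + z) / (1 - z)"
  have z: "1 - z \<noteq> 0" using assms by simp
  have y: "(1 - z) * ?y = 1 + z" "(1 - z)\<^sup>2 * (1 + ?y\<^sup>2) = 2 * (1 + z\<^sup>2)"
  proof -
    show *: "(1 - z) * ?y = 1 + z" using z by simp
    have "(1 - z)\<^sup>2 * (1 + ?y\<^sup>2) = (1 - z)\<^sup>2 + ((1 - z) * ?y)\<^sup>2"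
      by (simp only: distrib_left power_mult_distrib mult_1_right)
    also have "\<dots> = 2 * (1 + z\<^sup>2)"
      unfolding * by (simp add: algebra_simps power2_eq_square)
    finally show "(1 - z)\<^sup>2 * (1 + ?y\<^sup>2) = 2 * (1 + z\<^sup>2)" .
  qed
  have "(2 * (1 + z\<^sup>2)) ^ p * (1 + z) ^ (n - 2 * p) = (1 - z) ^ n * ((1 + ?y\<^sup>2) ^ p * ?y ^ (n - 2 * p))"
    if "2 * p \<le> n" for p
  proof -
    have "(1 - z) ^ n = (1 - z) ^ (2 * p + (n - 2 * p))" using that by simp
    also have "\<dots> = ((1 - z)\<^sup>2) ^ p * (1 - z) ^ (n - 2 * p)"
      by (simp only: power_add power_mult)
    finally have n: "(1 - z) ^ n = ((1 - z)\<^sup>2) ^ p * (1 - z) ^ (n - 2 * p)" .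
    show ?thesis
      by (subst y(1) [symmetric], subst y(2) [symmetric]) (simp only: n power_mult_distrib mult_ac)
  qed
  note term_eq = this
  have ev: "ev [:1, 0, 1:] x = 1 + x\<^sup>2" "ev [:1, 1:] x = 1 + x" "ev [:0, 1:] x = x" for x
    by (simp_all add: power2_eq_square)
  show ?thesis
    unfolding alt_eulerian_B_peaks Q1_peaks ev_sum sum_distrib_left ev_mult ev_power ev ev_numeral
    by (intro sum.cong refl term_eq) (erule two_peaks_le)
qed

end

interpretation fract_hom: real_field_hom "\<lambda>c. to_fract [:c:]"
proof
  show "to_fract [:a + b:] = to_fract [:a:] + to_fract [:b:]" for a b :: real
    unfolding to_fract_add [symmetric] by simp
  show "to_fract [:a * b:] = to_fract [:a:] * to_fract [:b:]" for a b :: real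
    unfolding to_fract_mult [symmetric] by simp
qed (simp_all flip: one_pCons)

interpretation complex_hom: real_field_hom complex_of_real
  by standard simp_all

lemma fract_ev_ratX: "fract_hom.ev p ratX = to_fract p"
proof (induction p)
  case (pCons a p)
  have "to_fract (pCons a p) = to_fract ([:a:] + [:0, 1:] * p)" by simp
  also have "\<dots> = to_fract [:a:] + ratX * to_fract p" by (simp only: to_fract_add to_fract_mult)
  finally show ?case by (simp only: fract_hom.ev_pCons pCons.IH)
qed simp

lemma ratX_neq_1: "ratX \<noteq> 1"
  by (metis to_fract_1 to_fract_eq_iff one_pCons pCons_eq_iff zero_neq_one)

lemma alt_eulerian_B_Q1:
  "to_fract (alt_eulerian_B n) = (1 - ratX) ^ n * fract_hom.ev (Q1 n) ((1 + ratX) / (1 - ratX))"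
  using fract_hom.ev_alt_eulerian_B[OF ratX_neq_1, of n] by (simp add: fract_ev_ratX)

text \<open>The image of the recurrence for \<^const>\<open>Q1\<close> under the substitution \<open>x \<mapsto> (1 + x) / (1 - x)\<close>.\<close>

lemma alt_eulerian_B_recurrence:
  "alt_eulerian_B (Suc n) = ([:1, 1:] + of_nat n * [:1, 0, 1:]) * alt_eulerian_B n +
     [:1, -1:] * [:1, 0, 1:] * pderiv (alt_eulerian_B n)"
proof -
  let ?u = "[:1, 0, 1:] :: real poly" and ?v = "[:1, 1:] :: real poly" and ?w = "[:1, -1:] :: real poly"
  let ?x = "[:0, 1:] :: real poly"
  let ?F = "\<lambda>n p. (2 * ?u) ^ p * ?v ^ (n - 2 * p)"
  have du: "pderiv ((2 * ?u) ^ p) = of_nat p * (4 * ?x) * (2 * ?u) ^ (p - 1)" for p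
    by (simp add: pderiv_power pderiv_pCons of_nat_poly numeral_poly mult.commute)
  have dv: "pderiv (?v ^ m) = of_nat m * ?v ^ (m - 1)" for m
    by (simp add: pderiv_power pderiv_pCons of_nat_poly)
  have rel: "?v = 2 - ?w" "?x = 1 - ?w" "2 * ?u = ?v\<^sup>2 + ?w\<^sup>2"
    by (simp_all add: numeral_poly one_pCons power2_eq_square)
  have alg: "(v + of_nat (2 * p + m) * u) * ((2 * u) ^ p * v ^ m) +
      w * u * ((2 * u) ^ p * (of_nat m * v ^ (m - 1)) + v ^ m * (of_nat p * (4 * x) * (2 * u) ^ (p - 1))) =
      of_nat (2 * p + 1) * ((2 * u) ^ p * v ^ Suc m) + of_nat m * ((2 * u) ^ Suc p * v ^ (m - 1))"
    if "v = 2 - w" "x = 1 - w" "2 * u = v\<^sup>2 + w\<^sup>2"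
    for p m :: nat and u v w x :: "real poly"
  proof -
    \<comment> \<open>The coefficient \<open>2 p + m\<close> of \<open>u\<close> is divided between
      the two derivatives: the part \<open>m\<close> joins that of \<open>v ^ m\<close> through
      \<open>w + v = 2\<close>, and the part \<open>2 p\<close> joins that of
      \<open>(2 * u) ^ p\<close> through \<open>2 * w * x + 2 * u = 2 * v\<close>.\<close>
    have 1: "w * u * (of_nat m * v ^ (m - 1)) + of_nat m * (u * v ^ m) = of_nat m * (2 * u * v ^ (m - 1))"
    proof (cases m)
      case (Suc k)
      have "of_nat m * u * v ^ k * (w + v) = of_nat m * u * v ^ k * 2"
        using that(1) by simp
      thus ?thesis by (simp add: Suc algebra_simps)
    qed simp
    have 2: "w * u * (of_nat p * (4 * x) * (2 * u) ^ (p - 1)) + of_nat (2 * p) * (u * (2 * u) ^ p) = of_nat (2 * p) * ((2 * u) ^ p * v)"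
    proof (cases p)
      case (Suc q)
      have "w * (2 * x) + 2 * u = 2 * v"
        unfolding that(3) that(1,2) by (simp add: algebra_simps power2_eq_square)
      hence "of_nat p * (2 * u) ^ Suc q * (w * (2 * x) + 2 * u) = of_nat p * (2 * u) ^ Suc q * (2 * v)"
        by (rule arg_cong)
      thus ?thesis by (simp add: Suc algebra_simps)
    qed simp
    have "(v + of_nat (2 * p + m) * u) * ((2 * u) ^ p * v ^ m) +
        w * u * ((2 * u) ^ p * (of_nat m * v ^ (m - 1)) + v ^ m * (of_nat p * (4 * x) * (2 * u) ^ (p - 1))) =
        (2 * u) ^ p * v ^ Suc m + v ^ m * (w * u * (of_nat p * (4 * x) * (2 * u) ^ (p - 1)) + of_nat (2 * p) * (u * (2 * u) ^ p)) +
        (2 * u) ^ p * (w * u * (of_nat m * v ^ (m - 1)) + of_nat m * (u * v ^ m))"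
      by (simp add: algebra_simps)
    thus ?thesis unfolding 1 2 by (simp add: algebra_simps)
  qed
  have "alt_eulerian_B (Suc n) = (\<Sum>\<tau> | \<tau> permutes {1..n}.
      of_nat (2 * peaks n \<tau> + 1) * ?F (Suc n) (peaks n \<tau>) +
      of_nat (n - 2 * peaks n \<tau>) * ?F (Suc n) (Suc (peaks n \<tau>)))"
    unfolding alt_eulerian_B_peaks by (rule sum_peaks_Suc)
  also have "\<dots> = (\<Sum>\<tau> | \<tau> permutes {1..n}.
      (?v + of_nat n * ?u) * ?F n (peaks n \<tau>) + ?w * ?u * pderiv (?F n (peaks n \<tau>)))"
  proof (intro sum.cong refl)
    fix \<tau> assume "\<tau> \<in> {\<tau>. \<tau> permutes {1..n}}"
    hence "2 * peaks n \<tau> \<le> n" by (rule two_peaks_le)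
    then obtain m where n: "n = 2 * peaks n \<tau> + m" using le_Suc_ex by blast
    let ?p = "peaks n \<tau>"
    have "(?v + of_nat (2 * ?p + m) * ?u) * ((2 * ?u) ^ ?p * ?v ^ m) + ?w * ?u * pderiv ((2 * ?u) ^ ?p * ?v ^ m) =
       of_nat (2 * ?p + 1) * ((2 * ?u) ^ ?p * ?v ^ Suc m) + of_nat m * ((2 * ?u) ^ Suc ?p * ?v ^ (m - 1))"
      unfolding pderiv_mult du dv by (rule alg[OF rel])
    moreover have "n - 2 * ?p = m" "Suc n - 2 * ?p = Suc m" "Suc n - 2 * Suc ?p = m - 1" "2 * ?p + m = n"
      using n by simp_all
    ultimately show "of_nat (2 * ?p + 1) * ?F (Suc n) ?p + of_nat (n - 2 * ?p) * ?F (Suc n) (Suc ?p) =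
        (?v + of_nat n * ?u) * ?F n ?p + ?w * ?u * pderiv (?F n ?p)"
      by (simp only:)
  qed
  also have "\<dots> = (?v + of_nat n * ?u) * alt_eulerian_B n + ?w * ?u * pderiv (alt_eulerian_B n)"
    unfolding alt_eulerian_B_peaks higher_pderiv_sum[of 1, simplified] sum_distrib_left sum.distrib ..
  finally show ?thesis .
qed

section \<open>Symmetry and unimodality\<close>

lemma peak_poly:
  fixes n p :: nat
  defines "F \<equiv> (2 * [:1, 0, 1:]) ^ p * [:1, 1:] ^ (n - 2 * p) :: real poly"
  assumes "2 * p \<le> n"
  shows degree_peak_poly: "degree F = n" and coeff_peak_poly_sym: "k \<le> n \<Longrightarrow> coeff F (n - k) = coeff F k"
    and coeff_0_peak_poly: "coeff F 0 = 2 ^ p" and coeff_1_peak_poly: "coeff F 1 = 2 ^ p * (of_nat n - 2 * of_nat p)"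
proof -
  have u: "2 * [:1, 0, 1:] = [:2, 0, 2 :: real:]" by (simp add: numeral_poly)
  show deg: "degree F = n"
    using assms(2) unfolding F_def u by (simp add: degree_mult_eq degree_power_eq)
  have "reflect_poly [:2, 0, 2 :: real:] = [:2, 0, 2:]" "reflect_poly [:1, 1 :: real:] = [:1, 1:]"
    by (simp_all add: reflect_poly_def)
  hence "reflect_poly F = F"
    unfolding F_def u by (simp only: reflect_poly_mult reflect_poly_power)
  thus "coeff F (n - k) = coeff F k" if "k \<le> n"
    using coeff_reflect_poly[of F k] deg that by simp
  show "coeff F 0 = 2 ^ p"
    by (simp add: poly_0_coeff_0 [symmetric] F_def)
  have "coeff F 1 = poly (pderiv F) 0"
    by (simp add: poly_0_coeff_0 coeff_pderiv)
  also have "\<dots> = 2 ^ p * of_nat (n - 2 * p)"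
    unfolding F_def u by (simp add: pderiv_mult pderiv_power pderiv_pCons)
  finally show "coeff F 1 = 2 ^ p * (of_nat n - 2 * of_nat p)"
    using assms(2) by (simp add: of_nat_diff)
qed

lemma coeff_alt_eulerian_B_sym:
  "k \<le> n \<Longrightarrow> coeff (alt_eulerian_B n) (n - k) = coeff (alt_eulerian_B n) k"
  unfolding alt_eulerian_B_peaks coeff_sum
  by (intro sum.cong refl coeff_peak_poly_sym) (erule two_peaks_le)

lemma coeff_0_alt_eulerian_B_pos: "coeff (alt_eulerian_B n) 0 > 0"
proof -
  have "coeff (alt_eulerian_B n) 0 = (\<Sum>\<tau> | \<tau> permutes {1..n}. 2 ^ peaks n \<tau>)"
    unfolding alt_eulerian_B_peaks coeff_sum
    by (intro sum.cong refl coeff_0_peak_poly) (erule two_peaks_le)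
  moreover have "{\<tau>. \<tau> permutes {1..n}} \<noteq> {}"
    using permutes_id by blast
  ultimately show ?thesis
    by (simp add: sum_pos finite_permutations)
qed

lemma degree_alt_eulerian_B: "degree (alt_eulerian_B n) = n"
proof (rule antisym)
  show "degree (alt_eulerian_B n) \<le> n"
    unfolding alt_eulerian_B_peaks
    by (rule degree_sum_le) (simp_all only: finite_permutations finite_atLeastAtMost degree_peak_poly two_peaks_le order.refl)
  show "n \<le> degree (alt_eulerian_B n)"
    using coeff_alt_eulerian_B_sym[of 0 n] coeff_0_alt_eulerian_B_pos[of n] by (intro le_degree) simp
qed

lemma symmetric_alt_eulerian_B: "symmetric_poly (alt_eulerian_B n)"
  unfolding symmetric_poly_def
  by (rule poly_eqI)
    (simp add: coeff_reflect_poly degree_alt_eulerian_B coeff_alt_eulerian_B_sym coeff_eq_0)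

text \<open>Integer indices keep the four-term coefficient recurrence free of boundary cases.\<close>

definition int_coeff :: "'a :: zero poly \<Rightarrow> int \<Rightarrow> 'a" where
  "int_coeff p k = (if k < 0 then 0 else coeff p (nat k))"

lemma int_coeff_recurrence:
  "int_coeff (alt_eulerian_B (Suc n)) k =
     of_int (k + 1) * int_coeff (alt_eulerian_B n) (k + 1) + of_int (int n + 1 - k) * int_coeff (alt_eulerian_B n) k +
     of_int k * int_coeff (alt_eulerian_B n) (k - 1) + of_int (int n - k + 2) * int_coeff (alt_eulerian_B n) (k - 2)"
proof (cases "k < 0")
  case True
  thus ?thesis by (cases "k = -1") (auto simp: int_coeff_def)
next
  case False
  then obtain j where k: "k = int j" by (metis nonneg_int_cases not_le)
  have P: "[:1, 1:] + of_nat n * [:1, 0, 1:] = [:1 + of_nat n, 1, of_nat n :: real:]"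
    "[:1, -1:] * [:1, 0, 1:] = [:1, -1, 1, -1 :: real:]"
    by (simp_all add: of_nat_poly)
  consider "j = 0" | "j = 1" | "j = 2" | i where "j = i + 3"
    by (metis One_nat_def Suc_1 add.commute add_Suc_right not0_implies_Suc numeral_3_eq_3 plus_nat.add_0)
  thus ?thesis
    unfolding alt_eulerian_B_recurrence P k
    by cases (simp_all add: int_coeff_def coeff_pderiv nat_add_distrib nat_diff_distrib algebra_simps eval_nat_numeral)
qed

lemma int_coeff_sym: "int_coeff (alt_eulerian_B n) (int n - k) = int_coeff (alt_eulerian_B n) k"
proof -
  have *: "coeff (alt_eulerian_B n) k = 0" if "k > n" for k
    using that by (intro coeff_eq_0) (simp add: degree_alt_eulerian_B)
  show ?thesis
  proof (cases "0 \<le> k \<and> k \<le> int n")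
    case True
    hence "nat (int n - k) = n - nat k" "nat k \<le> n" by auto
    thus ?thesis using True coeff_alt_eulerian_B_sym[of "nat k" n] by (simp add: int_coeff_def)
  qed (auto simp: int_coeff_def intro!: * *[symmetric])
qed

text \<open>Unimodality is a statement about the signs of these differences. They satisfy a
  four-term recurrence whose factors are nonnegative up to the middle, and the symmetry of the
  coefficients becomes antisymmetry.\<close>

definition coeff_diff :: "nat \<Rightarrow> int \<Rightarrow> real" where
  "coeff_diff n k = int_coeff (alt_eulerian_B n) k - int_coeff (alt_eulerian_B n) (k - 1)"

lemma coeff_diff_recurrence:
  "coeff_diff (Suc n) k =
     of_int (k + 1) * coeff_diff n (k + 1) + of_int (int n + 2 - k) * coeff_diff n k +
     of_int k * coeff_diff n (k - 1) + of_int (int n - k + 3) * coeff_diff n (k - 2)"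
  unfolding coeff_diff_def int_coeff_recurrence by (simp add: algebra_simps)

lemma coeff_diff_antisym:
  assumes "i + j = int n + 1" shows "coeff_diff n i = - coeff_diff n j"
proof -
  have i: "i = int n - (j - 1)" "i - 1 = int n - j" using assms by auto
  have "int_coeff (alt_eulerian_B n) i = int_coeff (alt_eulerian_B n) (j - 1)"
    unfolding i(1) by (rule int_coeff_sym)
  moreover have "int_coeff (alt_eulerian_B n) (i - 1) = int_coeff (alt_eulerian_B n) j"
    unfolding i(2) by (rule int_coeff_sym)
  ultimately show ?thesis by (simp add: coeff_diff_def)
qed

lemma coeff_diff_neg: "k < 0 \<Longrightarrow> coeff_diff n k = 0"
  by (simp add: coeff_diff_def int_coeff_def)

lemma alt_eulerian_B_0: "alt_eulerian_B 0 = 1"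
  by (simp add: alt_eulerian_B_peaks left_peaks_def)

lemma alt_eulerian_B_3: "alt_eulerian_B 3 = [:11, 13, 13, 11:]"
  and alt_eulerian_B_4: "alt_eulerian_B 4 = [:57, 76, 118, 76, 57:]"
proof -
  note rec = alt_eulerian_B_recurrence
  have 1: "alt_eulerian_B 1 = [:1, 1:]"
    using rec[of 0] by (simp add: alt_eulerian_B_0)
  have 2: "alt_eulerian_B 2 = [:3, 2, 3:]"
    using rec[of 1] 1 by (simp add: pderiv_pCons numeral_2_eq_2)
  show 3: "alt_eulerian_B 3 = [:11, 13, 13, 11:]"
    using rec[of 2] 2 by (simp add: pderiv_pCons numeral_3_eq_3 numeral_poly)
  show "alt_eulerian_B 4 = [:57, 76, 118, 76, 57:]"
    using rec[of 3] 3 by (simp add: pderiv_pCons numeral_poly)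
qed

text \<open>Only the term at \<open>k + 1\<close> in the recurrence can lie beyond the middle of the
  previous row. By antisymmetry it is then zero or the negative of the term at \<open>k\<close> or
  \<open>k - 1\<close>, which gives the case distinction. Two base rows are needed because the last
  case looks back two rows.\<close>

lemma coeff_diff_nonneg: "n \<ge> 3 \<Longrightarrow> 2 * k \<le> int n \<Longrightarrow> coeff_diff n k \<ge> 0"
proof (induction n arbitrary: k rule: less_induct)
  case (less n)
  consider "k < 0" | "n = 3" "k \<in> {0, 1}" | "n = 4" "k \<in> {0, 1, 2}" | "n \<ge> 5" "k \<ge> 0"
    using less.prems by force
  thus ?case
  proof cases
    case 1
    thus ?thesis by (simp add: coeff_diff_neg)
  next
    case 2
    thus ?thesis by (auto simp: coeff_diff_def int_coeff_def alt_eulerian_B_3)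
  next
    case 3
    thus ?thesis by (auto simp: coeff_diff_def int_coeff_def alt_eulerian_B_4 numeral_2_eq_2)
  next
    case 4
    then obtain m where "n = 2 + m" using le_Suc_ex[of 2 n] by auto
    hence n: "n = Suc (Suc m)" by simp
    let ?N = "Suc m"
    have m: "m \<ge> 3" using 4 n by simp
    have IH: "coeff_diff ?N j \<ge> 0" if "2 * j \<le> int ?N" for j
      using less.IH[of ?N j] that n m by simp
    have IH': "coeff_diff m j \<ge> 0" if "2 * j \<le> int m" for j
      using less.IH[of m j] that n m by simp
    have k: "2 * k \<le> int ?N + 1" using less.prems n by simp
    note anti = coeff_diff_antisym[of _ _ ?N]
    note rec = coeff_diff_recurrence[of ?N k]
    consider "2 * k + 2 \<le> int ?N" | "2 * k + 2 = int ?N + 1" | "2 * k = int ?N" | "2 * k = int ?N + 1"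
      using k by linarith
    thus ?thesis
    proof cases
      case 1
      thus ?thesis unfolding n rec
        using \<open>k \<ge> 0\<close> IH[of "k + 1"] IH[of k] IH[of "k - 1"] IH[of "k - 2"]
        by (intro add_nonneg_nonneg mult_nonneg_nonneg) simp_all
    next
      case 2
      have "coeff_diff ?N (k + 1) = 0" using anti[of "k + 1" "k + 1"] 2 by simp
      thus ?thesis unfolding n rec
        using 2 \<open>k \<ge> 0\<close> IH[of k] IH[of "k - 1"] IH[of "k - 2"]
        by (intro add_nonneg_nonneg mult_nonneg_nonneg) simp_all
    next
      case 3
      have "coeff_diff ?N (k + 1) = - coeff_diff ?N k"
        using anti[of "k + 1" k] 3 by simp
      hence "coeff_diff n k = coeff_diff ?N k + of_int k * coeff_diff ?N (k - 1) +
          of_int (int ?N - k + 3) * coeff_diff ?N (k - 2)"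
        unfolding n rec 3 [symmetric] by (simp add: algebra_simps)
      also have "\<dots> \<ge> 0"
        using 3 \<open>k \<ge> 0\<close> IH[of k] IH[of "k - 1"] IH[of "k - 2"]
        by (intro add_nonneg_nonneg mult_nonneg_nonneg) simp_all
      finally show ?thesis .
    next
      case 4
      \<comment> \<open>The recurrence produces the negative term \<open>- coeff_diff ?N (k - 1)\<close> here; it is absorbed only after
        unfolding the recurrence a second time.\<close>
      let ?d = "coeff_diff m"
      have k3: "k \<ge> 3" and mk: "int m = 2 * k - 2" and Nk: "int ?N = 2 * k - 1" using 4 m by simp_all
      have "coeff_diff ?N k = 0" "coeff_diff ?N (k + 1) = - coeff_diff ?N (k - 1)"
        using anti[of k k] anti[of "k + 1" "k - 1"] Nk by simp_all
      hence eq: "coeff_diff n k = of_int (k + 2) * coeff_diff ?N (k - 2) - coeff_diff ?N (k - 1)"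
        unfolding n rec Nk by (simp add: algebra_simps)
      have "?d k = - ?d (k - 1)"
        using coeff_diff_antisym[of k "k - 1" m] mk by simp
      hence 1: "coeff_diff ?N (k - 1) = ?d (k - 1) + of_int (k - 1) * ?d (k - 2) + of_int (k + 2) * ?d (k - 3)"
        unfolding coeff_diff_recurrence mk by (simp add: algebra_simps)
      have 2: "coeff_diff ?N (k - 2) = of_int (k - 1) * ?d (k - 1) + of_int (k + 2) * ?d (k - 2) +
          of_int (k - 2) * ?d (k - 3) + of_int (k + 3) * ?d (k - 4)"
        unfolding coeff_diff_recurrence mk by (simp add: algebra_simps)
      have "coeff_diff n k = of_int ((k + 2) * (k - 1) - 1) * ?d (k - 1) +
          of_int ((k + 2) * (k + 2) - (k - 1)) * ?d (k - 2) +
          of_int ((k + 2) * (k - 3)) * ?d (k - 3) + of_int ((k + 2) * (k + 3)) * ?d (k - 4)"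
        unfolding eq 1 2 by (simp add: algebra_simps)
      also have "\<dots> \<ge> 0"
      proof -
        have "1 * 1 \<le> (k + 2) * (k - 1)" using k3 by (intro mult_mono) auto
        moreover have "1 * (k - 1) \<le> (k + 2) * (k + 2)" using k3 by (intro mult_mono) auto
        ultimately show ?thesis
          using k3 mk by (intro add_nonneg_nonneg mult_nonneg_nonneg IH') (simp_all only: of_int_0_le_iff, simp_all)
      qed
      finally show ?thesis .
    qed
  qed
qed

lemma unimodal_alt_eulerian_B:
  assumes "n \<ge> 3" shows "unimodal_poly (alt_eulerian_B n)"
proof -
  let ?b = "coeff (alt_eulerian_B n)"
  have up: "?b k \<le> ?b (k + 1)" if "2 * (k + 1) \<le> n" for k
    using coeff_diff_nonneg[OF assms, of "int (k + 1)"] that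
    by (simp add: coeff_diff_def int_coeff_def nat_add_distrib)
  have down: "?b (k + 1) \<le> ?b k" if "n div 2 \<le> k" "k < n" for k
  proof -
    have sym: "?b k = ?b (n - k)" "?b (k + 1) = ?b (n - (k + 1))"
      using that coeff_alt_eulerian_B_sym[of k n] coeff_alt_eulerian_B_sym[of "k + 1" n] by simp_all
    show ?thesis
    proof (cases "n = 2 * k + 1")
      \<comment> \<open>The two middle coefficients for odd \<open>n\<close> are equal by symmetry;
        every other descent mirrors an instance of \<open>up\<close>.\<close>
      case True
      thus ?thesis using sym(1) by (simp add: mult_2)
    next
      case False
      hence "2 * (n - (k + 1) + 1) \<le> n" using that by presburger
      moreover have "n - (k + 1) + 1 = n - k" using that by simp
      ultimately show ?thesis using up[of "n - (k + 1)"] sym by simp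
    qed
  qed
  show ?thesis
    unfolding unimodal_poly_def degree_alt_eulerian_B
    by (rule exI[of _ "n div 2"]) (auto intro!: up[simplified] down[simplified])
qed

section \<open>Gamma expansions\<close>

text \<open>In each term the even part of the power of \<open>1 + x\<close> is expanded by
  \<open>(1 + x)^2 = 2 x + (1 + x^2)\<close>, which leaves \<open>(1 + x) ^ \<nu>\<close> as common
  factor; \<open>g k\<close> collects the binomial coefficients.\<close>

lemma semi_gamma_positive_alt_eulerian_B: "semi_gamma_positive (alt_eulerian_B n)"
proof -
  define N \<nu> where "N = n div 2" and "\<nu> = n mod 2"
  have n: "n = 2 * N + \<nu>" by (simp add: N_def \<nu>_def)
  let ?u = "[:1, 0, 1:] :: real poly" and ?v = "[:1, 1:] :: real poly" and ?x = "[:0, 1:] :: real poly"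
  define g :: "nat \<Rightarrow> real"
    where "g k = (\<Sum>\<tau> | \<tau> permutes {1..n}. 2 ^ peaks n \<tau> * (2 ^ k * of_nat ((N - peaks n \<tau>) choose k)))" for k
  have v2: "?v\<^sup>2 = 2 * ?x + ?u" by (simp add: power2_eq_square numeral_poly)
  have expand: "(2 * ?u) ^ p * ?v ^ (n - 2 * p) =
      ?v ^ \<nu> * (\<Sum>k\<le>N. smult (2 ^ p * (2 ^ k * of_nat ((N - p) choose k))) (?x ^ k * ?u ^ (N - k)))"
    if "p \<le> N" for p
  proof -
    have "?v ^ (n - 2 * p) = ?v ^ \<nu> * (?v\<^sup>2) ^ (N - p)"
      using that unfolding n power_mult [symmetric] power_add [symmetric]
      by (intro arg_cong[where f = "(^) ?v"]) simp
    also have "(?v\<^sup>2) ^ (N - p) = (\<Sum>k\<le>N - p. of_nat ((N - p) choose k) * (2 * ?x) ^ k * ?u ^ (N - p - k))"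
      unfolding v2 by (rule binomial_ring)
    also have "\<dots> = (\<Sum>k\<le>N. of_nat ((N - p) choose k) * (2 * ?x) ^ k * ?u ^ (N - p - k))"
      by (rule sum.mono_neutral_left) auto
    finally have "(2 * ?u) ^ p * ?v ^ (n - 2 * p) =
        ?v ^ \<nu> * (\<Sum>k\<le>N. (2 * ?u) ^ p * (of_nat ((N - p) choose k) * (2 * ?x) ^ k * ?u ^ (N - p - k)))"
      by (simp only: sum_distrib_left mult.left_commute)
    also have "(\<Sum>k\<le>N. (2 * ?u) ^ p * (of_nat ((N - p) choose k) * (2 * ?x) ^ k * ?u ^ (N - p - k))) =
        (\<Sum>k\<le>N. smult (2 ^ p * (2 ^ k * of_nat ((N - p) choose k))) (?x ^ k * ?u ^ (N - k)))"
    proof (intro sum.cong refl)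
      fix k
      show "(2 * ?u) ^ p * (of_nat ((N - p) choose k) * (2 * ?x) ^ k * ?u ^ (N - p - k)) =
        smult (2 ^ p * (2 ^ k * of_nat ((N - p) choose k))) (?x ^ k * ?u ^ (N - k))"
      proof (cases "k \<le> N - p")
        case True
        hence "?u ^ (N - k) = ?u ^ p * ?u ^ (N - p - k)"
          using that unfolding power_add [symmetric] by (intro arg_cong[where f = "(^) ?u"]) simp
        moreover have "smult (2 ^ p * (2 ^ k * of_nat c)) q = 2 ^ p * 2 ^ k * of_nat c * q" for c and q :: "real poly"
          by (simp add: numeral_poly of_nat_poly poly_const_pow mult_ac)
        ultimately show ?thesis unfolding power_mult_distrib by (simp only:) (simp only: mult_ac)
      qed (simp add: binomial_eq_0)
    qed
    finally show ?thesis .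
  qed
  have "alt_eulerian_B n = (\<Sum>\<tau> | \<tau> permutes {1..n}.
      ?v ^ \<nu> * (\<Sum>k\<le>N. smult (2 ^ peaks n \<tau> * (2 ^ k * of_nat ((N - peaks n \<tau>) choose k))) (?x ^ k * ?u ^ (N - k))))"
    unfolding alt_eulerian_B_peaks
  proof (intro sum.cong refl expand)
    fix \<tau> assume "\<tau> \<in> {\<tau>. \<tau> permutes {1..n}}"
    thus "peaks n \<tau> \<le> N" using two_peaks_le[of \<tau> n] by (simp add: N_def)
  qed
  also have "\<dots> = ?v ^ \<nu> * (\<Sum>k\<le>N. smult (g k) (?x ^ k * ?u ^ (N - k)))"
    unfolding sum_distrib_left [symmetric] g_def smult_sum
    by (intro arg_cong[where f = "(*) (?v ^ \<nu>)"] sum.swap)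
  finally have "alt_eulerian_B n = ?v ^ \<nu> * (\<Sum>k\<le>N. smult (g k) (?x ^ k * ?u ^ (N - k)))" .
  moreover have "\<forall>k\<le>N. g k \<ge> 0" by (auto simp: g_def intro!: sum_nonneg)
  ultimately show ?thesis
    unfolding semi_gamma_positive_def Let_def degree_alt_eulerian_B N_def [symmetric] \<nu>_def [symmetric]
    using symmetric_alt_eulerian_B by blast
qed

lemma alt_eulerian_B_left_peak_count:
  "alt_eulerian_B n = (\<Sum>k\<le>n. smult
     ((-4) ^ k * (\<Sum>i\<le>n. 2 ^ (i - k) * of_nat (left_peak_count n i) * of_nat (i choose k)))
     ([:0, 1:] ^ k * [:1, 1:] ^ (n - 2 * k)))"
proof -
  let ?u = "[:1, 0, 1:] :: real poly" and ?v = "[:1, 1:] :: real poly" and ?x = "[:0, 1:] :: real poly"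
  have u: "2 * ?u = - 4 * ?x + 2 * ?v\<^sup>2" by (simp add: power2_eq_square numeral_poly)
  have expand: "(2 * ?u) ^ i * ?v ^ (n - 2 * i) =
      (\<Sum>k\<le>n. smult ((-4) ^ k * (2 ^ (i - k) * of_nat (i choose k))) (?x ^ k * ?v ^ (n - 2 * k)))"
    if "2 * i \<le> n" for i
  proof -
    have "(2 * ?u) ^ i = (\<Sum>k\<le>i. of_nat (i choose k) * (- 4 * ?x) ^ k * (2 * ?v\<^sup>2) ^ (i - k))"
      unfolding u by (rule binomial_ring)
    also have "\<dots> = (\<Sum>k\<le>n. of_nat (i choose k) * (- 4 * ?x) ^ k * (2 * ?v\<^sup>2) ^ (i - k))"
      using that by (intro sum.mono_neutral_left) auto
    finally have "(2 * ?u) ^ i * ?v ^ (n - 2 * i) =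
        (\<Sum>k\<le>n. of_nat (i choose k) * (- 4 * ?x) ^ k * (2 * ?v\<^sup>2) ^ (i - k) * ?v ^ (n - 2 * i))"
      by (simp only: sum_distrib_right)
    also have "\<dots> = (\<Sum>k\<le>n. smult ((-4) ^ k * (2 ^ (i - k) * of_nat (i choose k))) (?x ^ k * ?v ^ (n - 2 * k)))"
    proof (intro sum.cong refl)
      fix k
      show "of_nat (i choose k) * (- 4 * ?x) ^ k * (2 * ?v\<^sup>2) ^ (i - k) * ?v ^ (n - 2 * i) =
          smult ((-4) ^ k * (2 ^ (i - k) * of_nat (i choose k))) (?x ^ k * ?v ^ (n - 2 * k))"
      proof (cases "k \<le> i")
        case True
        hence "?v ^ (n - 2 * k) = ?v\<^sup>2 ^ (i - k) * ?v ^ (n - 2 * i)"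
          using that unfolding power_mult [symmetric] power_add [symmetric]
          by (intro arg_cong[where f = "(^) ?v"]) simp
        moreover have "smult ((-4) ^ k * (2 ^ j * of_nat c)) q = (-4) ^ k * (2 ^ j * of_nat c) * q"
          for c j and q :: "real poly"
          by (simp add: numeral_poly of_nat_poly poly_const_pow mult_ac)
        ultimately show ?thesis unfolding power_mult_distrib by (simp only:) (simp only: mult_ac)
      qed (simp add: binomial_eq_0)
    qed
    finally show ?thesis .
  qed
  have fin: "finite {\<tau>. \<tau> permutes {1..n}}" by (simp add: finite_permutations)
  have "alt_eulerian_B n = (\<Sum>i\<le>n. \<Sum>\<tau> | \<tau> \<in> {\<tau>. \<tau> permutes {1..n}} \<and> peaks n \<tau> = i.
      (2 * ?u) ^ peaks n \<tau> * ?v ^ (n - 2 * peaks n \<tau>))"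
    unfolding alt_eulerian_B_peaks
  proof (rule sum.group[symmetric])
    show "peaks n ` {\<tau>. \<tau> permutes {1..n}} \<subseteq> {..n}"
      using two_peaks_le by fastforce
  qed (simp_all only: fin finite_atMost)
  also have "\<dots> = (\<Sum>i\<le>n. of_nat (left_peak_count n i) * ((2 * ?u) ^ i * ?v ^ (n - 2 * i)))"
    by (simp add: left_peak_count_def)
  also have "\<dots> = (\<Sum>i\<le>n. \<Sum>k\<le>n. smult ((-4) ^ k * (2 ^ (i - k) * of_nat (left_peak_count n i) * of_nat (i choose k)))
      (?x ^ k * ?v ^ (n - 2 * k)))"
  proof (intro sum.cong refl)
    fix i
    show "of_nat (left_peak_count n i) * ((2 * ?u) ^ i * ?v ^ (n - 2 * i)) =
      (\<Sum>k\<le>n. smult ((-4) ^ k * (2 ^ (i - k) * of_nat (left_peak_count n i) * of_nat (i choose k)))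
      (?x ^ k * ?v ^ (n - 2 * k)))"
    \<comment> \<open>The exponent \<open>n - 2 * i\<close> is truncated when
      \<open>2 * i > n\<close>, but then no permutation has \<open>i\<close> left peaks.\<close>
    proof (cases "left_peak_count n i = 0")
      case False
      then obtain \<tau> where "\<tau> permutes {1..n}" "peaks n \<tau> = i"
        unfolding left_peak_count_def by (metis (mono_tags, lifting) card.empty empty_Collect_eq)
      hence "2 * i \<le> n" using two_peaks_le[of \<tau> n] by simp
      thus ?thesis
        by (simp only: expand sum_distrib_left) (simp add: of_nat_poly mult_ac)
    qed simp
  qed
  also have "\<dots> = (\<Sum>k\<le>n. smult
     ((-4) ^ k * (\<Sum>i\<le>n. 2 ^ (i - k) * of_nat (left_peak_count n i) * of_nat (i choose k)))
     (?x ^ k * ?v ^ (n - 2 * k)))"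
    unfolding sum_distrib_left smult_sum by (rule sum.swap)
  finally show ?thesis .
qed

text \<open>Compare the two lowest coefficients. In a gamma-expansion of degree \<open>n\<close>
  only \<open>k = 0\<close> reaches the constant term, so the linear coefficient is at least
  \<open>n\<close> times the constant one. A permutation with \<open>p\<close> left peaks
  contributes these coefficients in the ratio \<open>n - 2 p\<close>, which is smaller as soon as
  \<open>p > 0\<close>.\<close>

lemma not_gamma_positive_alt_eulerian_B:
  assumes "n \<ge> 2" shows "\<not> gamma_positive (alt_eulerian_B n)"
proof
  let ?B = "alt_eulerian_B n"
  assume "gamma_positive ?B"
  then obtain g :: "nat \<Rightarrow> real" where g: "\<forall>k\<le>n div 2. g k \<ge> 0"
    and B: "?B = (\<Sum>k\<le>n div 2. smult (g k) ([:0, 1:] ^ k * [:1, 1:] ^ (n - 2 * k)))"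
    unfolding gamma_positive_def Let_def degree_alt_eulerian_B by blast
  have v0: "coeff ([:1, 1:] ^ m) 0 = (1 :: real)" for m
    by (simp add: poly_0_coeff_0 [symmetric])
  have v1: "coeff ([:1, 1:] ^ m) 1 = real m" for m
  proof -
    have "coeff ([:1, 1:] ^ m) 1 = poly (pderiv ([:1, 1:] ^ m :: real poly)) 0"
      by (simp add: poly_0_coeff_0 coeff_pderiv)
    thus ?thesis by (simp add: pderiv_power pderiv_pCons)
  qed
  have c: "coeff ([:0, 1:] ^ k * [:1, 1:] ^ (n - 2 * k)) 1 \<ge>
      real n * coeff ([:0, 1:] ^ k * [:1, 1:] ^ (n - 2 * k)) 0" for k
  proof (cases k)
    case 0
    thus ?thesis using v0[of n] v1[of n] by simp
  next
    case (Suc j)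
    have "coeff ([:0, 1:] ^ j * [:1, 1:] ^ m) 0 = (0 :: real) ^ j" for m
      by (simp add: poly_0_coeff_0 [symmetric])
    thus ?thesis by (simp add: Suc mult.assoc)
  qed
  have "real n * coeff ?B 0 \<le> coeff ?B 1"
    unfolding B coeff_sum sum_distrib_left coeff_smult
  proof (rule sum_mono)
    fix k assume "k \<in> {..n div 2}"
    thus "real n * (g k * coeff ([:0, 1:] ^ k * [:1, 1:] ^ (n - 2 * k)) 0) \<le>
        g k * coeff ([:0, 1:] ^ k * [:1, 1:] ^ (n - 2 * k)) 1"
      using mult_left_mono[OF c[of k], of "g k"] g by (simp add: mult_ac)
  qed
  moreover have "coeff ?B 1 < real n * coeff ?B 0"
  proof -
    \<comment> \<open>The arrangement \<open>2, 1, 3, ..., n\<close> has a left peak at position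
      1.\<close>
    let ?\<sigma> = "Transposition.transpose 1 (2 :: nat)"
    have \<sigma>: "?\<sigma> permutes {1..n}" using assms by (intro permutes_swap_id) auto
    have "1 \<in> left_peaks n ?\<sigma>"
      using assms by (simp add: left_peaks_def transpose_def)
    hence peak: "peaks n ?\<sigma> > 0" by (auto simp: card_gt_0_iff)
    have "coeff ?B 1 = (\<Sum>\<tau> | \<tau> permutes {1..n}. 2 ^ peaks n \<tau> * (real n - 2 * real (peaks n \<tau>)))"
      unfolding alt_eulerian_B_peaks coeff_sum
      by (intro sum.cong refl coeff_1_peak_poly) (erule two_peaks_le)
    also have "\<dots> < (\<Sum>\<tau> | \<tau> permutes {1..n}. real n * 2 ^ peaks n \<tau>)"
    proof (rule sum_strict_mono_ex1)
      show "\<exists>\<tau>\<in>{\<tau>. \<tau> permutes {1..n}}. 2 ^ peaks n \<tau> * (real n - 2 * real (peaks n \<tau>)) < real n * 2 ^ peaks n \<tau>"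
        using \<sigma> peak by (intro bexI[of _ ?\<sigma>]) (simp_all add: algebra_simps)
    qed (simp_all add: finite_permutations algebra_simps)
    also have "\<dots> = real n * coeff ?B 0"
      unfolding alt_eulerian_B_peaks coeff_sum sum_distrib_left
      by (intro sum.cong refl arg_cong[where f = "(*) (real n)"] coeff_0_peak_poly [symmetric])
        (erule two_peaks_le)
    finally show ?thesis .
  qed
  ultimately show False by simp
qed

section \<open>Exponential generating function\<close>

context real_field_hom
begin

text \<open>
  With \<open>u = (sin ct + y cos ct) / (cos ct - y sin ct)\<close> and \<open>f = 1 / (cos ct - y sin ct)\<close> one has \<open>f' = c f u\<close> and
  \<open>u' = c (1 + u\<^sup>2)\<close>, so the \<open>n\<close>-th derivative of \<open>f\<close> is \<open>c ^ n * f * Q1 n u\<close>.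
\<close>

lemma secant_nth:
  fixes c y :: 'a
  defines "D \<equiv> fps_cos c - fps_const y * fps_sin c"
  shows "inverse D $ n = c ^ n * ev (Q1 n) y / fact n"
proof -
  \<comment> \<open>\<open>Q1\<close> has to be evaluated at the power series \<open>u\<close> as
    well as at its constant term \<open>y\<close>.\<close>
  interpret fps: real_hom "\<lambda>a. fps_const (h a)"
    by standard (simp_all add: hom_add hom_mult)
  define f where "f = inverse D"
  define u where "u = (fps_sin c + fps_const y * fps_cos c) * f"
  have fD: "f * D = 1"
    unfolding f_def by (rule inverse_mult_eq_1) (simp add: D_def)
  have f0: "f $ 0 = 1" by (simp add: f_def D_def)
  have u0: "u $ 0 = y" by (simp add: u_def f0)
  have dD: "fps_deriv D = - (fps_const c * (fps_sin c + fps_const y * fps_cos c))"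
    by (simp add: D_def fps_sin_deriv fps_cos_deriv algebra_simps flip: fps_const_neg)
  have df: "fps_deriv f = fps_const c * f * u"
  proof -
    have "fps_deriv (f * D) = 0" by (simp add: fD)
    hence "fps_deriv f * D = fps_const c * (fps_sin c + fps_const y * fps_cos c) * f"
      by (simp add: dD algebra_simps)
    hence "fps_deriv f * D * f = fps_const c * (fps_sin c + fps_const y * fps_cos c) * f * f"
      by (rule arg_cong)
    moreover have "fps_deriv f * D * f = fps_deriv f * (f * D)" by (simp only: mult_ac)
    ultimately show ?thesis unfolding fD u_def by (simp only: mult_ac mult_1_left mult_1_right)
  qed
  have du: "fps_deriv u = fps_const c * (1 + u\<^sup>2)"
  proof -
    have "fps_const (- c) = - fps_const c" by simp
    hence "fps_deriv (fps_sin c + fps_const y * fps_cos c) =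
        fps_const c * fps_cos c + fps_const y * (- fps_const c * fps_sin c)"
      by (simp only: fps_deriv_add fps_deriv_mult_const_left fps_sin_deriv fps_cos_deriv)
    also have "\<dots> = fps_const c * D"
      unfolding D_def right_diff_distrib by (simp only: mult_minus_left mult_minus_right mult.left_commute diff_conv_add_uminus)
    finally have "fps_deriv u = fps_const c * (f * D) + fps_const c * (u * u)"
      unfolding u_def fps_deriv_mult df by (simp only: mult_ac add.commute)
    thus ?thesis by (simp only: fD power2_eq_square distrib_left)
  qed
  have dev: "fps_deriv (fps.ev p u) = fps.ev (pderiv p) u * fps_deriv u" for p
  proof (induction p)
    case (pCons a p)
    thus ?case
      unfolding pderiv_pCons fps.ev_add fps.ev_pCons fps_deriv_add fps_deriv_mult fps_deriv_const
      by (simp add: distrib_right mult.assoc)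
  qed simp
  have ev0: "fps.ev p u $ 0 = ev p y" for p
    by (induction p) (simp_all add: u0)
  have nth: "fps_nth_deriv n f = fps_const (c ^ n) * f * fps.ev (Q1 n) u" for n
  proof (induction n)
    case (Suc n)
    have "fps_nth_deriv (Suc n) f = fps_const (c ^ n) * (fps_deriv f * fps.ev (Q1 n) u + f * fps_deriv (fps.ev (Q1 n) u))"
      unfolding fps_nth_deriv_commute Suc.IH mult.assoc fps_deriv_mult_const_left fps_deriv_mult
      by (simp only: fps_deriv_const mult_zero_left add_0_left add.commute)
    also have "\<dots> = fps_const (c ^ Suc n) * f * (u * fps.ev (Q1 n) u + (1 + u\<^sup>2) * fps.ev (pderiv (Q1 n)) u)"
    proof -
      have "fps_const (c ^ Suc n) = fps_const c * fps_const (c ^ n)" by simp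
      thus ?thesis unfolding df dev du by (simp only: distrib_left distrib_right mult_ac mult_1_left)
    qed
    also have "u * fps.ev (Q1 n) u + (1 + u\<^sup>2) * fps.ev (pderiv (Q1 n)) u = fps.ev (Q1 (Suc n)) u"
      by (simp add: power2_eq_square del: mult_pCons_left)
    finally show ?case .
  qed simp
  have "fact n * f $ n = fps_nth_deriv n f $ 0"
    by (simp add: fps_deriv_maclauren_0)
  also have "\<dots> = c ^ n * ev (Q1 n) y"
    unfolding nth by (simp add: f0 ev0 del: fps_const_power)
  finally show ?thesis by (simp add: f_def field_simps)
qed

end

text \<open>Taking the factor \<open>1 - x\<close> out of the denominator leaves the secant-type
  series with \<open>c = 1 - x\<close> and \<open>y = (1 + x) / (1 - x)\<close>, whose coefficients
  are those of the substitution formula.\<close>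

lemma alt_eulerian_B_egf:
  "Abs_fps (\<lambda>n. to_fract (alt_eulerian_B n) / fact n) =
     fps_const (1 - ratX) /
       (fps_const (1 - ratX) * fps_cos (1 - ratX) - fps_const (1 + ratX) * fps_sin (1 - ratX))"
    (is "?f = _ / ?E")
proof -
  let ?c = "1 - ratX" and ?y = "(1 + ratX) / (1 - ratX)"
  let ?D = "fps_cos ?c - fps_const ?y * fps_sin ?c"
  have c: "?c \<noteq> 0" using ratX_neq_1 by simp
  have E: "?E = fps_const ?c * ?D"
    using c by (simp add: right_diff_distrib mult.assoc [symmetric])
  have "?f = inverse ?D"
    by (rule fps_ext) (simp only: fps_nth_Abs_fps fract_hom.secant_nth alt_eulerian_B_Q1)
  hence "?f * ?D = 1" using inverse_mult_eq_1[of ?D] by simp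
  hence fE: "?f * ?E = fps_const ?c" by (simp add: E mult_ac)
  have "?E \<noteq> 0"
  proof
    assume "?E = 0"
    hence "?E $ 0 = 0" by simp
    thus False using c by simp
  qed
  hence "?f * ?E / ?E = ?f" by (rule nonzero_mult_div_cancel_right)
  thus ?thesis unfolding fE by (rule sym)
qed

section \<open>Continued fraction and strong q-log-convexity\<close>

text \<open>
  The Stieltjes matrix of the J-fraction: its first column consists of the coefficients of the fraction, and
  the tails of the fraction are quotients of the generating functions of consecutive columns.
\<close>

fun moment_table :: "(nat \<Rightarrow> 'a :: comm_semiring_1) \<Rightarrow> (nat \<Rightarrow> 'a) \<Rightarrow> nat \<Rightarrow> nat \<Rightarrow> 'a" where
  "moment_table r s 0 i = of_bool (i = 0)"
| "moment_table r s (Suc n) i = (if i = 0 then 0 else moment_table r s n (i - 1)) +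
     r i * moment_table r s n i + s (i + 1) * moment_table r s n (i + 1)"

lemma moment_table_zero: "n < i \<Longrightarrow> moment_table r s n i = 0"
  by (induction n arbitrary: i) auto

lemma moment_table_diag: "moment_table r s n n = 1"
  by (induction n) (auto simp: moment_table_zero)

lemma jfrac_tendsto:
  fixes r s :: "nat \<Rightarrow> 'a :: field"
  shows "(\<lambda>m. jfrac r s m 0) \<longlonglongrightarrow> Abs_fps (\<lambda>n. moment_table r s n 0)"
proof -
  \<comment> \<open>Column \<open>i\<close> starts with \<open>i\<close> zeros followed by 1.
    Dropping the zeros gives constant term 1, so the quotients \<open>\<phi> i\<close> are power
    series.\<close>
  define V where "V i = Abs_fps (\<lambda>n. moment_table r s (n + i) i)" for i
  define P where "P i = (if i = 0 then 1 else V (i - 1))" for i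
  define \<phi> where "\<phi> i = V i * inverse (P i)" for i
  let ?R = "\<lambda>i. fps_const (r i) * fps_X" and ?S = "\<lambda>i. fps_const (s (i + 1)) * fps_X ^ 2"
  have V0: "V i $ 0 = 1" for i by (simp add: V_def moment_table_diag)
  have P0: "P i $ 0 = 1" for i by (simp add: P_def V0)
  have \<phi>P: "\<phi> i * P i = V i" for i
    using inverse_mult_eq_1[of "P i"] P0[of i] by (simp add: \<phi>_def mult.assoc)
  have V_rec: "V i = P i + ?R i * V i + ?S i * V (i + 1)" for i
  proof (rule fps_ext)
    fix n
    have shift: "moment_table r s (n + i) i = P i $ n +
        r i * (if n + i = 0 then 0 else moment_table r s (n + i - 1) i) +
        s (i + 1) * (if n + i = 0 then 0 else moment_table r s (n + i - 1) (i + 1))"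
    proof (cases "n + i")
      case (Suc k)
      thus ?thesis by (cases i) (auto simp: P_def V_def)
    qed (simp add: P_def)
    have X1: "(fps_X * V i) $ n = (if n + i = 0 then 0 else moment_table r s (n + i - 1) i)"
      by (cases n) (auto simp: V_def moment_table_zero)
    have X2: "(fps_X ^ 2 * V (i + 1)) $ n = (if n + i = 0 then 0 else moment_table r s (n + i - 1) (i + 1))"
    proof (cases "n < 2")
      case True
      hence "moment_table r s (n + i - 1) (i + 1) = 0" by (intro moment_table_zero) simp
      thus ?thesis using True by (simp only: fps_X_power_mult_nth if_True if_cancel)
    next
      case False
      hence "n - 2 + (i + 1) = n + i - 1" by simp
      thus ?thesis using False by (simp only: fps_X_power_mult_nth V_def fps_nth_Abs_fps) simp
    qed
    show "V i $ n = (P i + ?R i * V i + ?S i * V (i + 1)) $ n"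
      unfolding fps_add_nth mult.assoc fps_mult_left_const_nth X1 X2 shift [symmetric]
      by (simp only: V_def fps_nth_Abs_fps)
  qed
  have \<phi>_rec: "\<phi> i * (1 - ?R i - ?S i * \<phi> (i + 1)) = 1" for i
  proof -
    have "P i * (\<phi> i * (1 - ?R i - ?S i * \<phi> (i + 1))) = (\<phi> i * P i) - ?R i * (\<phi> i * P i) - ?S i * (\<phi> (i + 1) * (\<phi> i * P i))"
      by (simp add: algebra_simps)
    also have "\<dots> = V i - ?R i * V i - ?S i * V (i + 1)"
    proof -
      have "\<phi> (i + 1) * V i = V (i + 1)" using \<phi>P[of "i + 1"] by (simp add: P_def)
      thus ?thesis by (simp only: \<phi>P)
    qed
    also have "\<dots> = P i * 1"
      using V_rec[of i] by (simp add: algebra_simps)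
    finally have "P i * (\<phi> i * (1 - ?R i - ?S i * \<phi> (i + 1))) = P i * 1" .
    moreover have "P i \<noteq> 0" using P0[of i] by auto
    ultimately show ?thesis by (simp only: mult_cancel_left) simp
  qed
  \<comment> \<open>Each level multiplies the error of the truncated tail by
    \<open>fps_X ^ 2\<close>, more than enough to gain one correct coefficient per level.\<close>
  have agree: "jfrac r s m i $ n = \<phi> i $ n" if "n < m" for m i n
    using that
  proof (induction m arbitrary: i n)
    case (Suc m)
    let ?J = "jfrac r s m (i + 1)"
    let ?D = "1 - ?R i - ?S i * ?J"
    have "?D $ 0 = 1" by (simp add: power2_eq_square)
    hence "jfrac r s (Suc m) i * ?D = 1"
      by (simp add: fps_divide_unit inverse_mult_eq_1)
    hence J: "jfrac r s (Suc m) i * (?D * \<phi> i) = \<phi> i"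
      by (simp add: mult.assoc [symmetric])
    have "?D = (1 - ?R i - ?S i * \<phi> (i + 1)) - ?S i * (?J - \<phi> (i + 1))"
      by (simp add: algebra_simps)
    hence "?D * \<phi> i = 1 - ?S i * (?J - \<phi> (i + 1)) * \<phi> i"
      using \<phi>_rec[of i] by (simp add: algebra_simps)
    have alg: "F - p = x * ((F * c * p) * q)" if "F * t = p" "t = 1 - c * x * q * p" for F t p x c q :: "'a fps"
    proof -
      have "F - F * t = x * ((F * c * p) * q)" unfolding that(2) by (simp add: algebra_simps)
      thus ?thesis by (simp only: that(1))
    qed
    have diff: "jfrac r s (Suc m) i - \<phi> i =
        fps_X ^ 2 * ((jfrac r s (Suc m) i * fps_const (s (i + 1)) * \<phi> i) * (?J - \<phi> (i + 1)))"
      by (rule alg[OF J]) fact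
    have "((jfrac r s (Suc m) i * fps_const (s (i + 1)) * \<phi> i) * (?J - \<phi> (i + 1))) $ k = 0" if "k < m" for k
      unfolding fps_mult_nth[of _ "?J - \<phi> (i + 1)"] using that Suc.IH
      by (intro sum.neutral) auto
    hence "(jfrac r s (Suc m) i - \<phi> i) $ n = 0"
      unfolding diff fps_X_power_mult_nth using Suc.prems by auto
    thus ?case by simp
  qed simp
  have "\<phi> 0 = Abs_fps (\<lambda>n. moment_table r s n 0)"
    by (simp add: \<phi>_def P_def V_def)
  moreover have "(\<lambda>m. jfrac r s m 0) \<longlonglongrightarrow> \<phi> 0"
  proof (rule tendsto_fpsI)
    show "eventually (\<lambda>m. jfrac r s m 0 $ n = \<phi> 0 $ n) sequentially" for n
      using agree by (intro eventually_sequentiallyI[of "Suc n"]) simp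
  qed
  ultimately show ?thesis by simp
qed

text \<open>Divided by \<open>((i + 1)!)^2\<close>, this is the three-term recurrence of a Stieltjes
  matrix with \<open>r i = (2 i + 1) x\<close> and \<open>s i = i^2 (1 + x^2)\<close>.\<close>

lemma higher_pderiv_Q1_Suc:
  "(pderiv ^^ Suc i) (Q1 (Suc n)) = of_nat (2 * i + 3) * [:0, 1:] * (pderiv ^^ Suc i) (Q1 n) +
     of_nat ((i + 1)\<^sup>2) * (pderiv ^^ i) (Q1 n) + [:1, 0, 1:] * (pderiv ^^ Suc (Suc i)) (Q1 n)"
proof -
  let ?x = "[:0, 1:] :: real poly" and ?u = "[:1, 0, 1:] :: real poly"
  have d: "pderiv ?x = 1" "pderiv ?u = 2 * ?x" "pderiv (of_nat k) = (0 :: real poly)" for k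
    by (simp_all add: pderiv_pCons one_pCons numeral_poly of_nat_poly)
  show ?thesis
  proof (induction i)
    case 0
    show ?case
      unfolding Q1.simps by (simp add: pderiv_add pderiv_mult d algebra_simps del: mult_pCons_left mult_pCons_right)
  next
    case (Suc i)
    have "(pderiv ^^ Suc (Suc i)) (Q1 (Suc n)) = pderiv ((pderiv ^^ Suc i) (Q1 (Suc n)))"
      by simp
    also note Suc
    finally show ?case
      by (simp add: pderiv_add pderiv_mult d algebra_simps power2_eq_square del: mult_pCons_left mult_pCons_right of_nat_Suc of_nat_add of_nat_mult)
        (simp add: algebra_simps del: mult_pCons_left mult_pCons_right)
  qed
qed

definition B_r :: "nat \<Rightarrow> real poly" where
  "B_r i = of_nat (2 * i + 1) * [:1, 1:]"

definition B_s :: "nat \<Rightarrow> real poly" where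
  "B_s i = of_nat (2 * i ^ 2) * [:1, 0, 1:]"

text \<open>The Stieltjes matrix of \<^const>\<open>Q1\<close> itself is the matrix of scaled derivatives \<open>Q1 n ^ (i) / (i!)\<^sup>2\<close>.\<close>

lemma (in real_field_hom) ev_moment_table:
  assumes "z \<noteq> 1"
  shows "ev (moment_table B_r B_s n i) z =
    (1 - z) ^ n / (1 - z) ^ i * ev ((pderiv ^^ i) (Q1 n)) ((1 + z) / (1 - z)) / (fact i)\<^sup>2"
proof (induction n arbitrary: i)
  case 0
  have "(pderiv ^^ i) 1 = (0 :: real poly)" if "i > 0" using that by (cases i) (simp_all only: funpow_Suc_right o_apply pderiv_1 higher_pderiv_0)
  thus ?case by (cases "i = 0") auto
next
  case (Suc n)
  define c where "c = 1 - z"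
  define y where "y = (1 + z) / (1 - z)"
  have c: "c \<noteq> 0" using assms by (simp add: c_def)
  have cy: "1 + z = c * y" using c by (simp add: c_def y_def)
  \<comment> \<open>The factor 2 in \<open>B_s\<close> originates here: rescaling by
    \<open>c\<close> turns \<open>1 + y^2\<close> into \<open>2 * (1 + z^2)\<close>.\<close>
  have c2: "2 * (1 + z\<^sup>2) = c\<^sup>2 * (1 + y\<^sup>2)"
  proof -
    have "2 * (1 + z\<^sup>2) = c\<^sup>2 + (1 + z)\<^sup>2" by (simp add: c_def algebra_simps power2_eq_square)
    thus ?thesis unfolding cy by (simp add: algebra_simps power_mult_distrib)
  qed
  have ev: "ev [:1, 1:] z = c * y" "ev [:1, 0, 1:] y = 1 + y\<^sup>2" "ev [:0, 1:] y = y"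
    by (simp_all add: cy power2_eq_square)
  have ev_s: "ev (B_s i) z = of_nat (i\<^sup>2) * (c\<^sup>2 * (1 + y\<^sup>2))" for i
    unfolding c2 [symmetric] by (simp add: B_s_def power2_eq_square algebra_simps)
  have ev_r: "ev (B_r i) z = of_nat (2 * i + 1) * (c * y)" for i
    by (simp only: B_r_def ev_mult ev_of_nat ev)
  define q where "q i = ev ((pderiv ^^ i) (Q1 n)) y" for i
  have IH: "ev (moment_table B_r B_s n i) z = c ^ n / c ^ i * q i / (fact i)\<^sup>2" for i
    using Suc.IH[of i] by (simp add: c_def y_def q_def)
  show ?case
  proof (cases i)
    case 0
    have "ev (Q1 (Suc n)) y = y * q 0 + (1 + y\<^sup>2) * q 1"
      by (simp add: q_def power2_eq_square del: mult_pCons_left)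
    thus ?thesis
      unfolding y_def [symmetric] unfolding c_def [symmetric] using c
      by (simp add: 0 IH ev_r ev_s del: Q1.simps) (simp add: field_simps power2_eq_square)
  next
    case (Suc j)
    have "ev ((pderiv ^^ Suc j) (Q1 (Suc n))) y =
        of_nat (2 * j + 3) * y * q (Suc j) + of_nat ((j + 1)\<^sup>2) * q j + (1 + y\<^sup>2) * q (Suc (Suc j))"
      by (simp only: higher_pderiv_Q1_Suc ev_add ev_mult ev_of_nat ev q_def)
    hence rhs: "ev ((pderiv ^^ i) (Q1 (Suc n))) y =
        of_nat (2 * i + 1) * y * q i + (of_nat i)\<^sup>2 * q j + (1 + y\<^sup>2) * q (Suc i)"
      by (simp only: Suc) (simp add: algebra_simps)
    have alg: "C / d * qj / a\<^sup>2 + e * (c * y) * (C / (c * d) * qi / (k * a)\<^sup>2) +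
        l\<^sup>2 * (c\<^sup>2 * (1 + y\<^sup>2)) * (C / (c * (c * d)) * qk / (l * (k * a))\<^sup>2) =
        c * C / (c * d) * (e * y * qi + k\<^sup>2 * qj + (1 + y\<^sup>2) * qk) / (k * a)\<^sup>2"
      if "d \<noteq> 0" "a \<noteq> 0" "k \<noteq> 0" "l \<noteq> 0" for C d a e k l qi qj qk :: 'a
      using that c by (simp add: field_simps power2_eq_square)
    have "ev (moment_table B_r B_s (Suc n) i) z = ev (moment_table B_r B_s n j) z +
        ev (B_r i) z * ev (moment_table B_r B_s n i) z + ev (B_s (Suc i)) z * ev (moment_table B_r B_s n (Suc i)) z"
      by (simp add: Suc)
    also have "\<dots> = c ^ n / c ^ j * q j / (fact j)\<^sup>2 +
        of_nat (2 * i + 1) * (c * y) * (c ^ n / (c * c ^ j) * q i / (of_nat i * fact j)\<^sup>2) +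
        (of_nat (Suc i))\<^sup>2 * (c\<^sup>2 * (1 + y\<^sup>2)) *
        (c ^ n / (c * (c * c ^ j)) * q (Suc i) / (of_nat (Suc i) * (of_nat i * fact j))\<^sup>2)"
      unfolding IH ev_r ev_s by (simp only: Suc fact_Suc power_Suc of_nat_power)
    also have "\<dots> = c * c ^ n / (c * c ^ j) *
        (of_nat (2 * i + 1) * y * q i + (of_nat i)\<^sup>2 * q j + (1 + y\<^sup>2) * q (Suc i)) / (of_nat i * fact j)\<^sup>2"
      using c by (intro alg) (simp_all add: Suc del: of_nat_Suc)
    also have "\<dots> = c ^ Suc n / c ^ i * ev ((pderiv ^^ i) (Q1 (Suc n))) y / (fact i)\<^sup>2"
      unfolding rhs by (simp only: Suc fact_Suc power_Suc)
    finally show ?thesis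
      unfolding y_def [symmetric] unfolding c_def [symmetric] .
  qed
qed

text \<open>In column 0 no derivative is taken, so the entry is the substitution formula; the
  identity returns to polynomials because \<open>to_fract\<close> is injective.\<close>

lemma moment_table_alt_eulerian_B: "moment_table B_r B_s n 0 = alt_eulerian_B n"
proof -
  have "to_fract (moment_table B_r B_s n 0) = to_fract (alt_eulerian_B n)"
    using fract_hom.ev_moment_table[OF ratX_neq_1, of n 0]
    by (simp add: fract_ev_ratX alt_eulerian_B_Q1)
  thus ?thesis by simp
qed


lemma alt_eulerian_B_jfrac:
  "(\<lambda>m. jfrac (\<lambda>i. of_nat (2 * i + 1) * (1 + ratX)) (\<lambda>i. of_nat (2 * i ^ 2) * (1 + ratX ^ 2)) m 0)
     \<longlonglongrightarrow> Abs_fps (\<lambda>n. to_fract (alt_eulerian_B n))"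
proof -
  have of_nat: "to_fract (of_nat k) = (of_nat k :: real poly fract)" for k
    by (induction k) simp_all
  have ratX: "to_fract [:1, 1:] = 1 + ratX" "to_fract [:1, 0, 1:] = 1 + ratX ^ 2"
  proof -
    have "[:1, 1:] = 1 + [:0, 1 :: real:]" "[:1, 0, 1:] = 1 + [:0, 1 :: real:] * [:0, 1:]"
      by (simp_all add: one_pCons)
    thus "to_fract [:1, 1:] = 1 + ratX" "to_fract [:1, 0, 1:] = 1 + ratX ^ 2"
      by (simp_all only: to_fract_add to_fract_mult to_fract_1 power2_eq_square)
  qed
  have rs: "(\<lambda>i. of_nat (2 * i + 1) * (1 + ratX)) = (\<lambda>i. to_fract (B_r i))"
    "(\<lambda>i. of_nat (2 * i ^ 2) * (1 + ratX ^ 2)) = (\<lambda>i. to_fract (B_s i))"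
    by (simp_all only: B_r_def B_s_def to_fract_mult of_nat ratX)
  have hom: "to_fract (moment_table r s n i) = moment_table (\<lambda>i. to_fract (r i)) (\<lambda>i. to_fract (s i)) n i"
    for r s :: "nat \<Rightarrow> real poly" and n i
    by (induction n arbitrary: i) simp_all
  show ?thesis
    unfolding rs moment_table_alt_eulerian_B [symmetric] hom by (rule jfrac_tendsto)
qed

section \<open>Total positivity of 2 by 2 minors and strong q-log-convexity\<close>

definition nonneg_coeffs :: "real poly \<Rightarrow> bool" where
  "nonneg_coeffs p \<longleftrightarrow> (\<forall>k. coeff p k \<ge> 0)"

lemma nonneg_coeffs_0 [simp]: "nonneg_coeffs 0"
  by (simp add: nonneg_coeffs_def)

lemma nonneg_coeffs_1 [simp]: "nonneg_coeffs 1"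
  by (simp add: nonneg_coeffs_def)

lemma nonneg_coeffs_pCons [simp]: "nonneg_coeffs (pCons a p) \<longleftrightarrow> a \<ge> 0 \<and> nonneg_coeffs p"
proof
  assume "nonneg_coeffs (pCons a p)"
  hence "coeff (pCons a p) k \<ge> 0" for k by (simp add: nonneg_coeffs_def)
  from this[of 0] this[of "Suc _"] show "a \<ge> 0 \<and> nonneg_coeffs p"
    by (simp add: nonneg_coeffs_def)
next
  assume "a \<ge> 0 \<and> nonneg_coeffs p"
  thus "nonneg_coeffs (pCons a p)"
    by (simp add: nonneg_coeffs_def coeff_pCons split: nat.split)
qed

lemma nonneg_coeffs_add: "nonneg_coeffs p \<Longrightarrow> nonneg_coeffs q \<Longrightarrow> nonneg_coeffs (p + q)"
  by (simp add: nonneg_coeffs_def)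

lemma nonneg_coeffs_mult: "nonneg_coeffs p \<Longrightarrow> nonneg_coeffs q \<Longrightarrow> nonneg_coeffs (p * q)"
  by (simp add: nonneg_coeffs_def coeff_mult sum_nonneg)

lemma nonneg_coeffs_moment_table:
  assumes "\<And>i. nonneg_coeffs (r i)" "\<And>i. nonneg_coeffs (s i)"
  shows "nonneg_coeffs (moment_table r s n i)"
proof (induction n arbitrary: i)
  case (Suc n)
  have "nonneg_coeffs (if i = 0 then 0 else moment_table r s n (i - 1))"
    using Suc.IH by simp
  thus ?case
    unfolding moment_table.simps by (intro nonneg_coeffs_add nonneg_coeffs_mult assms Suc.IH)
qed simp

text \<open>Cauchy-Binet for adjacent columns. Their bands overlap in two rows, so the minor of
  \<open>a1\<close> and \<open>a2\<close> arises twice with opposite signs; this is the origin of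
  \<open>r * r' - s\<close>.\<close>

lemma tridiagonal_minor_adjacent:
  fixes r r' s s' :: "'a :: comm_ring_1"
  shows "(a0 + r * a1 + s * a2) * (b1 + r' * b2 + s' * b3) - (a1 + r' * a2 + s' * a3) * (b0 + r * b1 + s * b2) =
    (a0 * b1 - a1 * b0) + r' * (a0 * b2 - a2 * b0) + s' * (a0 * b3 - a3 * b0) +
    (r * r' - s) * (a1 * b2 - a2 * b1) + r * s' * (a1 * b3 - a3 * b1) + s * s' * (a2 * b3 - a3 * b2)"
  by (simp add: algebra_simps)

lemma tridiagonal_minor:
  fixes r r' s s' :: "'a :: comm_ring_1"
  shows "(a0 + r * a1 + s * a2) * (b3 + r' * b4 + s' * b5) - (a3 + r' * a4 + s' * a5) * (b0 + r * b1 + s * b2) =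
    (a0 * b3 - a3 * b0) + r' * (a0 * b4 - a4 * b0) + s' * (a0 * b5 - a5 * b0) +
    r * (a1 * b3 - a3 * b1) + r * r' * (a1 * b4 - a4 * b1) + r * s' * (a1 * b5 - a5 * b1) +
    s * (a2 * b3 - a3 * b2) + s * r' * (a2 * b4 - a4 * b2) + s * s' * (a2 * b5 - a5 * b2)"
  by (simp add: algebra_simps)

text \<open>
  Row \<open>a + 1\<close> of the table is row \<open>a\<close> times a fixed tridiagonal matrix.  By Cauchy--Binet it suffices that
  the 2 by 2 minors of that matrix are nonnegative, and the only one with a negative term is
  \<open>r i * r (i + 1) - s (i + 1)\<close>.
\<close>

lemma moment_table_minors_nonneg:
  assumes r: "\<And>i. nonneg_coeffs (r i)" and s: "\<And>i. nonneg_coeffs (s i)"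
    and rs: "\<And>i. nonneg_coeffs (r i * r (i + 1) - s (i + 1))"
    and "i < j"
  shows "nonneg_coeffs (moment_table r s a i * moment_table r s (a + d) j -
      moment_table r s a j * moment_table r s (a + d) i)"
  using \<open>i < j\<close>
proof (induction a arbitrary: i j)
  case 0
  thus ?case using nonneg_coeffs_moment_table[OF r s] by (cases "i = 0") simp_all
next
  case (Suc a)
  define A where "A = moment_table r s a"
  define B where "B = moment_table r s (a + d)"
  define A' where "A' = (if i = 0 then 0 else A (i - 1))"
  define B' where "B' = (if i = 0 then 0 else B (i - 1))"
  have IH: "nonneg_coeffs (A k * B l - A l * B k)" if "k < l" for k l
    using Suc.IH[OF that] by (simp add: A_def B_def)
  \<comment> \<open>\<open>A'\<close> and \<open>B'\<close> stand for column \<open>i - 1\<close>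
    and vanish at the border \<open>i = 0\<close>.\<close>
  have IH': "nonneg_coeffs (A' * B l - A l * B')" if "i \<le> l" for l
    using IH[of "i - 1" l] that by (simp add: A'_def B'_def)
  note nn = nonneg_coeffs_add nonneg_coeffs_mult r s rs
  have step: "moment_table r s (Suc a) i = A' + r i * A i + s (i + 1) * A (i + 1)"
    "moment_table r s (Suc a + d) i = B' + r i * B i + s (i + 1) * B (i + 1)"
    by (simp_all add: A'_def B'_def A_def B_def)
  have step': "moment_table r s (Suc a) j = A (j - 1) + r j * A j + s (j + 1) * A (j + 1)"
    "moment_table r s (Suc a + d) j = B (j - 1) + r j * B j + s (j + 1) * B (j + 1)"
    using Suc.prems by (simp_all add: A_def B_def)
  show ?case
  proof (cases "j = i + 1")
    case True
    have "nonneg_coeffs (moment_table r s (Suc a) i * moment_table r s (Suc a + d) (i + 1) -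
        moment_table r s (Suc a) (i + 1) * moment_table r s (Suc a + d) i)"
      unfolding step tridiagonal_minor_adjacent step'[unfolded True add_diff_cancel_right']
      by (intro nn IH IH'; simp)
    thus ?thesis by (simp only: True)
  next
    case False
    hence "i + 1 < j" using Suc.prems by simp
    \<comment> \<open>For \<open>j = i + 2\<close> the two bands share the column
      \<open>i + 1 = j - 1\<close>, and this minor is zero.\<close>
    have corner: "nonneg_coeffs (A (i + 1) * B (j - 1) - A (j - 1) * B (i + 1))"
      using IH[of "i + 1" "j - 1"] \<open>i + 1 < j\<close> by (cases "i + 1 = j - 1") simp_all
    show ?thesis
      unfolding step step' tridiagonal_minor
      using \<open>i + 1 < j\<close> by (intro nn corner IH IH'; simp)
  qed
qed

lemma strongly_q_log_convex_alt_eulerian_B: "strongly_q_log_convex alt_eulerian_B"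
  unfolding strongly_q_log_convex_def
proof (intro allI impI)
  fix n m k :: nat assume "n \<ge> m \<and> m \<ge> 1"
  then obtain a d where m: "m = Suc a" and n: "n = a + d"
    by (metis Suc_le_D One_nat_def Suc_leD le_Suc_ex)
  let ?T = "moment_table B_r B_s"
  have r: "nonneg_coeffs (B_r i)" and s: "nonneg_coeffs (B_s i)" for i
    by (simp_all add: B_r_def B_s_def of_nat_poly)
  have rs: "nonneg_coeffs (B_r i * B_r (i + 1) - B_s (i + 1))" for i
  proof -
    \<comment> \<open>Here \<open>(1 + x)^2\<close> is split as \<open>(1 + x^2) + 2 x\<close>, and
      \<open>(2 i + 1) (2 i + 3) - 2 (i + 1)^2 = 2 i^2 + 4 i + 1\<close>.\<close>
    have "B_r i * B_r (i + 1) - B_s (i + 1) = of_nat (2 * i\<^sup>2 + 4 * i + 1) * [:1, 0, 1:] +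
        of_nat (2 * ((2 * i + 1) * (2 * i + 3))) * [:0, 1:]"
      by (simp add: B_r_def B_s_def of_nat_poly algebra_simps power2_eq_square)
    thus ?thesis by (simp only:) (intro nonneg_coeffs_add nonneg_coeffs_mult; simp add: of_nat_poly)
  qed
  have col0: "?T (Suc p) 0 = B_r 0 * ?T p 0 + B_s 1 * ?T p 1" for p by simp
  have "alt_eulerian_B (n + 1) * alt_eulerian_B (m - 1) - alt_eulerian_B n * alt_eulerian_B m =
      ?T (Suc (a + d)) 0 * ?T a 0 - ?T (a + d) 0 * ?T (Suc a) 0"
    by (simp only: moment_table_alt_eulerian_B m n) simp
  \<comment> \<open>Unfolding one row, the terms with \<open>B_r 0\<close> cancel, and a minor of
    columns 0 and 1 remains.\<close>
  also have "\<dots> = B_s 1 * (?T a 0 * ?T (a + d) 1 - ?T a 1 * ?T (a + d) 0)"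
    unfolding col0 by (simp only: algebra_simps)
  finally have "nonneg_coeffs (alt_eulerian_B (n + 1) * alt_eulerian_B (m - 1) - alt_eulerian_B n * alt_eulerian_B m)"
    by (simp only:) (intro nonneg_coeffs_mult moment_table_minors_nonneg r s rs; simp)
  thus "coeff (alt_eulerian_B (n + 1) * alt_eulerian_B (m - 1) - alt_eulerian_B n * alt_eulerian_B m) k \<ge> 0"
    by (simp add: nonneg_coeffs_def)
qed

section \<open>Hurwitz stability\<close>

text \<open>The sign is that of \<open>Re (w * cnj (w - z))\<close>, and
  \<open>Re (w * cnj z)\<close> is at most \<open>norm w\<close>, which is less than
  \<open>(norm w)^2\<close>.\<close>

lemma Re_divide_diff_pos:
  assumes "norm z \<le> 1" "norm w > 1" shows "Re (w / (w - z)) > 0"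
proof -
  have "Re (w * cnj z) \<le> norm w * norm z"
    using complex_Re_le_cmod[of "w * cnj z"] by (simp add: norm_mult)
  also have "\<dots> \<le> norm w * 1" using assms by (intro mult_left_mono) auto
  also have "\<dots> < norm w * norm w" using assms by (intro mult_strict_left_mono) auto
  also have "\<dots> = Re (w * cnj w)"
    unfolding power2_eq_square [symmetric] cmod_power2 by (simp add: power2_eq_square)
  finally have "Re (w * cnj z) < Re (w * cnj w)" .
  thus ?thesis by (simp add: Re_complex_div_gt_0 right_diff_distrib)
qed

text \<open>The logarithmic derivative times \<open>w\<close> is the sum of
  \<open>w / (w - z)\<close> over the roots \<open>z\<close>; the induction splits off one root at a
  time.\<close>

lemma Re_log_deriv_nonneg:
  fixes p :: "complex poly"
  assumes "\<And>z. poly p z = 0 \<Longrightarrow> norm z \<le> 1" "norm w > 1"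
  shows "Re (w * poly (pderiv p) w / poly p w) \<ge> 0"
  using assms(1)
proof (induction "degree p" arbitrary: p)
  case 0
  then obtain c where "p = [:c:]" by (metis degree_eq_zeroE)
  thus ?case by (simp add: pderiv_pCons)
next
  case (Suc d)
  hence "\<not> constant (poly p)" by (simp add: constant_degree)
  then obtain z where z: "poly p z = 0" using fundamental_theorem_of_algebra by blast
  then obtain q where p: "p = [:- z, 1:] * q" by (metis dvdE poly_eq_0_iff_dvd)
  have "q \<noteq> 0" using Suc.hyps(2) p by auto
  hence "degree p = Suc (degree q)"
    unfolding p by (subst degree_mult_eq) simp_all
  hence "degree q = d" using Suc.hyps(2) by simp
  moreover have roots: "norm y \<le> 1" if "poly q y = 0" for y
    using Suc.prems[of y] that by (simp add: p)
  ultimately have IH: "Re (w * poly (pderiv q) w / poly q w) \<ge> 0"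
    using Suc.hyps(1)[of q] by blast
  have alg: "w * (b + t * c) / (t * b) = w / t + w * c / b" if "t \<noteq> 0" "b \<noteq> 0" for b c t :: complex
    using that by (simp add: field_simps)
  have "poly q w \<noteq> 0" using roots[of w] assms(2) by auto
  moreover have "w - z \<noteq> 0" using Suc.prems[OF z] assms(2) by auto
  moreover have "poly (pderiv p) w = poly q w + (w - z) * poly (pderiv q) w"
    by (simp add: p pderiv_mult pderiv_pCons del: mult_pCons_left)
  moreover have "poly p w = (w - z) * poly q w"
    by (simp add: p algebra_simps)
  ultimately have "w * poly (pderiv p) w / poly p w = w / (w - z) + w * poly (pderiv q) w / poly q w"
    by (simp only: alg not_False_eq_True)
  moreover have "Re (w / (w - z)) > 0"
    using Re_divide_diff_pos[OF Suc.prems[OF z] assms(2)] .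
  ultimately show ?case using IH by simp
qed

text \<open>
  Dividing the recurrence by \<open>(1 + w\<^sup>2) * Q1 n w / w\<close> gives \<open>w\<^sup>2 / (1 + w\<^sup>2)\<close> plus \<open>w\<close> times the logarithmic
  derivative of \<open>Q1 n\<close>; outside the unit disk the former has positive and the latter nonnegative real part.
\<close>

lemma Q1_nonzero_outside_disk:
  assumes "norm w > 1" shows "complex_hom.ev (Q1 n) w \<noteq> 0"
  using assms
proof (induction n arbitrary: w)
  case (Suc n)
  define p where "p = map_poly complex_of_real (Q1 n)"
  have p: "complex_hom.ev (Q1 n) x = poly p x" for x
    by (simp add: complex_hom.ev_def p_def)
  have "map_poly complex_of_real (pderiv (Q1 n)) = pderiv p"
    by (rule poly_eqI) (simp add: p_def coeff_map_poly coeff_pderiv)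
  hence dp: "complex_hom.ev (pderiv (Q1 n)) w = poly (pderiv p) w"
    by (simp add: complex_hom.ev_def)
  have pw: "poly p w \<noteq> 0" using Suc.IH[OF Suc.prems] by (simp add: p)
  let ?A = "w * poly (pderiv p) w / poly p w"
  have "Re ?A \<ge> 0"
  proof (rule Re_log_deriv_nonneg[OF _ Suc.prems])
    show "norm z \<le> 1" if "poly p z = 0" for z
      using Suc.IH[of z] that p[of z] by (metis not_le)
  qed
  moreover have w2: "norm (w\<^sup>2) > 1" using Suc.prems by (simp add: norm_power one_less_power)
  \<comment> \<open>The fraction has the form \<open>v / (v - z)\<close> with \<open>v = w^2\<close>
    and \<open>z = -1\<close>, a point on the unit circle.\<close>
  hence "Re (w\<^sup>2 / (w\<^sup>2 - (-1))) > 0" by (intro Re_divide_diff_pos) simp_all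
  ultimately have "Re (w\<^sup>2 / (1 + w\<^sup>2) + ?A) > 0" by (simp add: add.commute)
  hence "w\<^sup>2 / (1 + w\<^sup>2) + ?A \<noteq> 0" by fastforce
  moreover have nz: "1 + w\<^sup>2 \<noteq> 0" using w2 by (metis add_eq_0_iff less_irrefl norm_minus_cancel norm_one)
  moreover have "w * complex_hom.ev (Q1 (Suc n)) w = poly p w * ((1 + w\<^sup>2) * (w\<^sup>2 / (1 + w\<^sup>2) + ?A))"
  proof -
    have "w * complex_hom.ev (Q1 (Suc n)) w = w * (w * poly p w + (1 + w\<^sup>2) * poly (pderiv p) w)"
      by (simp add: p dp power2_eq_square del: mult_pCons_left)
    also have "\<dots> = poly p w * (w\<^sup>2 + (1 + w\<^sup>2) * ?A)"
      using pw by (simp add: field_simps power2_eq_square)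
    also have "w\<^sup>2 + (1 + w\<^sup>2) * ?A = (1 + w\<^sup>2) * (w\<^sup>2 / (1 + w\<^sup>2) + ?A)"
      using nz by (simp add: distrib_left)
    finally show ?thesis .
  qed
  ultimately show ?case using pw by auto
qed simp

text \<open>The map from \<open>z\<close> to \<open>(1 + z) / (1 - z)\<close> sends the open right
  half-plane without 1 outside the closed unit disk, where \<open>Q1 n\<close> has no zeros. At its
  pole \<open>z = 1\<close> the peak expansion is a sum of positive numbers.\<close>

lemma hurwitz_stable_alt_eulerian_B: "hurwitz_stable (alt_eulerian_B n)"
proof -
  have "complex_hom.ev (alt_eulerian_B n) z \<noteq> 0" if "Re z > 0" for z
  proof (cases "z = 1")
    case True
    have "complex_hom.ev (alt_eulerian_B n) 1 =
        of_nat (\<Sum>\<tau> | \<tau> permutes {1..n}. (2 * 2) ^ peaks n \<tau> * 2 ^ (n - 2 * peaks n \<tau>))"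
      by (simp add: alt_eulerian_B_peaks del: mult_pCons_left)
    moreover have "(\<Sum>\<tau> | \<tau> permutes {1..n}. (2 * 2) ^ peaks n \<tau> * 2 ^ (n - 2 * peaks n \<tau>)) > (0 :: nat)"
    proof (rule sum_pos)
      show "{\<tau>. \<tau> permutes {1..n}} \<noteq> {}" using permutes_id by blast
    qed (simp_all add: finite_permutations)
    ultimately show ?thesis by (simp only: True of_nat_eq_0_iff neq0_conv)
  next
    case False
    have "(cmod (1 - z))\<^sup>2 < (cmod (1 + z))\<^sup>2"
      using that unfolding cmod_power2 by (simp add: power2_eq_square algebra_simps)
    hence "cmod (1 - z) < cmod (1 + z)" by (rule power_less_imp_less_base) simp
    hence "norm ((1 + z) / (1 - z)) > 1" using False by (simp add: norm_divide)
    thus ?thesis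
      using False Q1_nonzero_outside_disk by (simp add: complex_hom.ev_alt_eulerian_B)
  qed
  thus ?thesis by (simp add: hurwitz_stable_def complex_hom.ev_def)
qed

theorem theorem4p16:
  shows
    "(\<forall>n. to_fract (alt_eulerian_B n) =
        (1 - ratX) ^ n * poly (map_poly (\<lambda>c. to_fract [:c:]) (Q1 n)) ((1 + ratX) / (1 - ratX)))
   \<and> (\<forall>n\<ge>3. symmetric_poly (alt_eulerian_B n) \<and> unimodal_poly (alt_eulerian_B n))
   \<and> Abs_fps (\<lambda>n. to_fract (alt_eulerian_B n) / fact n) =
        fps_const (1 - ratX) /
          (fps_const (1 - ratX) * fps_cos (1 - ratX) - fps_const (1 + ratX) * fps_sin (1 - ratX))
   \<and> (\<lambda>m. jfrac (\<lambda>i. of_nat (2 * i + 1) * (1 + ratX)) (\<lambda>i. of_nat (2 * i ^ 2) * (1 + ratX ^ 2)) m 0)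
        \<longlonglongrightarrow> Abs_fps (\<lambda>n. to_fract (alt_eulerian_B n))
   \<and> strongly_q_log_convex alt_eulerian_B
   \<and> (\<forall>n\<ge>1. hurwitz_stable (alt_eulerian_B n) \<and> semi_gamma_positive (alt_eulerian_B n))
   \<and> (\<forall>n. alt_eulerian_B n =
        (\<Sum>k\<le>n. smult
          ((-4) ^ k * (\<Sum>i\<le>n. 2 ^ (i - k) * of_nat (left_peak_count n i) * of_nat (i choose k)))
          ([:0, 1:] ^ k * [:1, 1:] ^ (n - 2 * k))))
   \<and> (\<forall>n\<ge>2. \<not> gamma_positive (alt_eulerian_B n))"
proof (intro conjI allI impI)
  show "to_fract (alt_eulerian_B n) =
      (1 - ratX) ^ n * poly (map_poly (\<lambda>c. to_fract [:c:]) (Q1 n)) ((1 + ratX) / (1 - ratX))" for n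
    by (simp only: alt_eulerian_B_Q1 fract_hom.ev_def)
qed (rule symmetric_alt_eulerian_B unimodal_alt_eulerian_B alt_eulerian_B_egf alt_eulerian_B_jfrac
    strongly_q_log_convex_alt_eulerian_B hurwitz_stable_alt_eulerian_B semi_gamma_positive_alt_eulerian_B
    alt_eulerian_B_left_peak_count not_gamma_positive_alt_eulerian_B; assumption)+

end
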